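(* Each of the following three varieties has the finite embeddability property: the variety generated by all conservative residuated lattices; the variety generated by all commutative conservative residuated lattices; and the variety of semilinear idempotent residuated lattices.
   Context: A residuated lattice is an algebra $\mathbf A=\langle A,\wedge,\vee,\cdot,\backslash,/,\mathrm e\rangle$ such that $\langle A,\wedge,\vee\rangle$ is a lattice, $\langle A,\cdot,\mathrm e\rangle$ is a monoid, and for all $a,b,c\in A$: $b\le a\backslash c\iff a\cdot b\le c\iff a\le c/b$. It is idempotent if $aa=a$ for all $a$, commutative if $ab=ba$ for all $a,b$, and conservative if $ab\in\{a,b\}$ for all $a,b\in A$. The variety of semilinear idempotent residuated lattices is the variety generated by all totally ordered idempotent residuated lattices. A variety $\mathsf V$ has the finite embeddability property if for every $\mathbf A\in\mathsf V$ and every finite subset $B\subseteq A$, the partial subalgebra $\mathbf B$ of $\mathbf A$ on $B$ embeds into some finite $\mathbf D\in\mathsf V$, i.e., there is an injective map $h\colon B\to D$ such that for every basic operation $f$ and $b_1,\dots,b_k\in B$ with $f^{\mathbf A}(b_1,\dots,b_k)\in B$, $h(f^{\mathbf A}(b_1,\dots,b_k))=f^{\mathbf D}(h(b_1),\dots,h(b_k))$. *)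

theory Defs
  imports "HOL-Algebra.Group" "HOL-Library.Countable_Set"
begin

record 'a rlat = "'a monoid" +
  rmeet :: "'a \<Rightarrow> 'a \<Rightarrow> 'a"
  rjoin :: "'a \<Rightarrow> 'a \<Rightarrow> 'a"
  ldiv :: "'a \<Rightarrow> 'a \<Rightarrow> 'a"  \<comment> \<open>\<open>ldiv A a c\<close> is the left residual, a under c\<close>
  rdiv :: "'a \<Rightarrow> 'a \<Rightarrow> 'a"  \<comment> \<open>\<open>rdiv A c b\<close> is the right residual, c over b\<close>

definition rle :: "'a rlat \<Rightarrow> 'a \<Rightarrow> 'a \<Rightarrow> bool" where
  "rle A a b \<longleftrightarrow> rmeet A a b = a"

text \<open>Only the values of the operations on the carrier matter.\<close>

locale residuated_lattice = monoid A for A :: "'a rlat" +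
  assumes rmeet_closed: "\<lbrakk>a \<in> carrier A; b \<in> carrier A\<rbrakk> \<Longrightarrow> rmeet A a b \<in> carrier A"
    and rjoin_closed: "\<lbrakk>a \<in> carrier A; b \<in> carrier A\<rbrakk> \<Longrightarrow> rjoin A a b \<in> carrier A"
    and ldiv_closed: "\<lbrakk>a \<in> carrier A; b \<in> carrier A\<rbrakk> \<Longrightarrow> ldiv A a b \<in> carrier A"
    and rdiv_closed: "\<lbrakk>a \<in> carrier A; b \<in> carrier A\<rbrakk> \<Longrightarrow> rdiv A a b \<in> carrier A"
    and rmeet_assoc: "\<lbrakk>a \<in> carrier A; b \<in> carrier A; c \<in> carrier A\<rbrakk>
      \<Longrightarrow> rmeet A (rmeet A a b) c = rmeet A a (rmeet A b c)"
    and rjoin_assoc: "\<lbrakk>a \<in> carrier A; b \<in> carrier A; c \<in> carrier A\<rbrakk>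
      \<Longrightarrow> rjoin A (rjoin A a b) c = rjoin A a (rjoin A b c)"
    and rmeet_comm: "\<lbrakk>a \<in> carrier A; b \<in> carrier A\<rbrakk> \<Longrightarrow> rmeet A a b = rmeet A b a"
    and rjoin_comm: "\<lbrakk>a \<in> carrier A; b \<in> carrier A\<rbrakk> \<Longrightarrow> rjoin A a b = rjoin A b a"
    and rmeet_absorb: "\<lbrakk>a \<in> carrier A; b \<in> carrier A\<rbrakk> \<Longrightarrow> rmeet A a (rjoin A a b) = a"
    and rjoin_absorb: "\<lbrakk>a \<in> carrier A; b \<in> carrier A\<rbrakk> \<Longrightarrow> rjoin A a (rmeet A a b) = a"
    and ldiv_residual: "\<lbrakk>a \<in> carrier A; b \<in> carrier A; c \<in> carrier A\<rbrakk>
      \<Longrightarrow> rle A b (ldiv A a c) \<longleftrightarrow> rle A (a \<otimes>\<^bsub>A\<^esub> b) c"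
    and rdiv_residual: "\<lbrakk>a \<in> carrier A; b \<in> carrier A; c \<in> carrier A\<rbrakk>
      \<Longrightarrow> rle A a (rdiv A c b) \<longleftrightarrow> rle A (a \<otimes>\<^bsub>A\<^esub> b) c"

definition idempotent :: "'a rlat \<Rightarrow> bool" where
  "idempotent A \<longleftrightarrow> (\<forall>a\<in>carrier A. a \<otimes>\<^bsub>A\<^esub> a = a)"

definition commutative :: "'a rlat \<Rightarrow> bool" where
  "commutative A \<longleftrightarrow> (\<forall>a\<in>carrier A. \<forall>b\<in>carrier A. a \<otimes>\<^bsub>A\<^esub> b = b \<otimes>\<^bsub>A\<^esub> a)"

definition conservative :: "'a rlat \<Rightarrow> bool" where
  "conservative A \<longleftrightarrow> (\<forall>a\<in>carrier A. \<forall>b\<in>carrier A. a \<otimes>\<^bsub>A\<^esub> b \<in> {a, b})"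

definition totally_ordered :: "'a rlat \<Rightarrow> bool" where
  "totally_ordered A \<longleftrightarrow> (\<forall>a\<in>carrier A. \<forall>b\<in>carrier A. rle A a b \<or> rle A b a)"

definition conservative_rls :: "'a rlat set" where
  "conservative_rls = {A. residuated_lattice A \<and> conservative A}"

definition commutative_conservative_rls :: "'a rlat set" where
  "commutative_conservative_rls = {A. residuated_lattice A \<and> commutative A \<and> conservative A}"

definition totally_ordered_idempotent_rls :: "'a rlat set" where
  "totally_ordered_idempotent_rls =
     {A. residuated_lattice A \<and> totally_ordered A \<and> idempotent A}"

datatype rterm =
  Var nat
| Unit
| Mult rterm rterm
| Meet rterm rterm
| Join rterm rterm
| LDiv rterm rterm
| RDiv rterm rterm

primrec eval_term :: "'a rlat \<Rightarrow> (nat \<Rightarrow> 'a) \<Rightarrow> rterm \<Rightarrow> 'a" where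
  "eval_term A \<rho> (Var n) = \<rho> n"
| "eval_term A \<rho> Unit = \<one>\<^bsub>A\<^esub>"
| "eval_term A \<rho> (Mult s t) = eval_term A \<rho> s \<otimes>\<^bsub>A\<^esub> eval_term A \<rho> t"
| "eval_term A \<rho> (Meet s t) = rmeet A (eval_term A \<rho> s) (eval_term A \<rho> t)"
| "eval_term A \<rho> (Join s t) = rjoin A (eval_term A \<rho> s) (eval_term A \<rho> t)"
| "eval_term A \<rho> (LDiv s t) = ldiv A (eval_term A \<rho> s) (eval_term A \<rho> t)"
| "eval_term A \<rho> (RDiv s t) = rdiv A (eval_term A \<rho> s) (eval_term A \<rho> t)"

definition satisfies :: "'a rlat \<Rightarrow> rterm \<times> rterm \<Rightarrow> bool" where
  "satisfies A e \<longleftrightarrow>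
     (\<forall>\<rho>. range \<rho> \<subseteq> carrier A \<longrightarrow> eval_term A \<rho> (fst e) = eval_term A \<rho> (snd e))"

text \<open>
  A variety of residuated lattices has members over every type, whereas a HOL set of algebras
  lives over one type. A variety is therefore represented by a set \<open>E\<close> of equations,
  and \<open>models E\<close> is the class of its members over the type at hand. The variety
  generated by a class \<open>K\<close> is the least equational class containing \<open>K\<close>; it is
  represented by the set of all equations valid in \<open>K\<close>.
\<close>

definition models :: "(rterm \<times> rterm) set \<Rightarrow> 'a rlat set" where
  "models E = {A. residuated_lattice A \<and> (\<forall>e\<in>E. satisfies A e)}"

definition equations_of :: "'a rlat set \<Rightarrow> (rterm \<times> rterm) set" where
  "equations_of K = {e. \<forall>A\<in>K. satisfies A e}"

definition preserves_op ::
  "'a set \<Rightarrow> ('a \<Rightarrow> 'b) \<Rightarrow> ('a \<Rightarrow> 'a \<Rightarrow> 'a) \<Rightarrow> ('b \<Rightarrow> 'b \<Rightarrow> 'b) \<Rightarrow> bool" where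
  "preserves_op B h f g \<longleftrightarrow>
     (\<forall>x\<in>B. \<forall>y\<in>B. f x y \<in> B \<longrightarrow> h (f x y) = g (h x) (h y))"

definition partial_embedding ::
  "'a rlat \<Rightarrow> 'a set \<Rightarrow> 'b rlat \<Rightarrow> ('a \<Rightarrow> 'b) \<Rightarrow> bool" where
  "partial_embedding A B D h \<longleftrightarrow>
     h ` B \<subseteq> carrier D \<and> inj_on h B \<and>
     (\<one>\<^bsub>A\<^esub> \<in> B \<longrightarrow> h \<one>\<^bsub>A\<^esub> = \<one>\<^bsub>D\<^esub>) \<and>
     preserves_op B h (mult A) (mult D) \<and>
     preserves_op B h (rmeet A) (rmeet D) \<and>
     preserves_op B h (rjoin A) (rjoin D) \<and>
     preserves_op B h (ldiv A) (ldiv D) \<and>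
     preserves_op B h (rdiv A) (rdiv D)"

text \<open>
  The finite embeddability property of the variety axiomatized by \<open>E\<close>, for its members
  over the type \<open>'a\<close>. A finite algebra has an isomorphic copy with carrier in
  \<open>nat\<close>, so looking for \<open>D\<close> over \<open>nat\<close> is no restriction.
\<close>

definition finite_embeddability_property :: "'a itself \<Rightarrow> (rterm \<times> rterm) set \<Rightarrow> bool" where
  "finite_embeddability_property _ E \<longleftrightarrow>
     (\<forall>A \<in> (models E :: 'a rlat set). \<forall>B. B \<subseteq> carrier A \<and> finite B \<longrightarrow>
        (\<exists>D \<in> (models E :: nat rlat set). finite (carrier D) \<and>
           (\<exists>h. partial_embedding A B D h)))"

text \<open>
  The equations of the three generating classes do not depend on the type from which the
  generating algebras are taken, provided it is infinite: an equation that fails in some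
  algebra fails in a countable subalgebra, and the classes are closed under isomorphic copies
  of subalgebras.
\<close>

lemma eval_term_closed:
  assumes "residuated_lattice A" "range \<rho> \<subseteq> carrier A"
  shows "eval_term A \<rho> t \<in> carrier A"
proof -
  interpret residuated_lattice A by fact
  show ?thesis
    using assms(2)
    by (induction t) (auto simp: rmeet_closed rjoin_closed ldiv_closed rdiv_closed)
qed

definition transported :: "('a \<Rightarrow> 'b) \<Rightarrow> 'a set \<Rightarrow> 'a rlat \<Rightarrow> 'b rlat" where
  "transported f S A =
    (let g = inv_into S f; tr = (\<lambda>op x y. f (op (g x) (g y)))
     in \<lparr>carrier = f ` S, mult = tr (mult A), one = f \<one>\<^bsub>A\<^esub>,
         rmeet = tr (rmeet A), rjoin = tr (rjoin A), ldiv = tr (ldiv A), rdiv = tr (rdiv A)\<rparr>)"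

lemma transported_simps:
  assumes "inj_on f S"
  shows "carrier (transported f S A) = f ` S"
    and "\<one>\<^bsub>transported f S A\<^esub> = f \<one>\<^bsub>A\<^esub>"
    and "\<lbrakk>x \<in> S; y \<in> S\<rbrakk> \<Longrightarrow> f x \<otimes>\<^bsub>transported f S A\<^esub> f y = f (x \<otimes>\<^bsub>A\<^esub> y)"
    and "\<lbrakk>x \<in> S; y \<in> S\<rbrakk> \<Longrightarrow> rmeet (transported f S A) (f x) (f y) = f (rmeet A x y)"
    and "\<lbrakk>x \<in> S; y \<in> S\<rbrakk> \<Longrightarrow> rjoin (transported f S A) (f x) (f y) = f (rjoin A x y)"
    and "\<lbrakk>x \<in> S; y \<in> S\<rbrakk> \<Longrightarrow> ldiv (transported f S A) (f x) (f y) = f (ldiv A x y)"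
    and "\<lbrakk>x \<in> S; y \<in> S\<rbrakk> \<Longrightarrow> rdiv (transported f S A) (f x) (f y) = f (rdiv A x y)"
  using assms by (simp_all add: transported_def Let_def)

locale transport = residuated_lattice A for A :: "'a rlat" +
  fixes S :: "'a set" and f :: "'a \<Rightarrow> 'b"
  assumes sub: "S \<subseteq> carrier A" and inj: "inj_on f S"
    and S_one: "\<one>\<^bsub>A\<^esub> \<in> S"
    and S_ops: "\<lbrakk>x \<in> S; y \<in> S\<rbrakk> \<Longrightarrow> x \<otimes>\<^bsub>A\<^esub> y \<in> S" "\<lbrakk>x \<in> S; y \<in> S\<rbrakk> \<Longrightarrow> rmeet A x y \<in> S"
      "\<lbrakk>x \<in> S; y \<in> S\<rbrakk> \<Longrightarrow> rjoin A x y \<in> S" "\<lbrakk>x \<in> S; y \<in> S\<rbrakk> \<Longrightarrow> ldiv A x y \<in> S"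
      "\<lbrakk>x \<in> S; y \<in> S\<rbrakk> \<Longrightarrow> rdiv A x y \<in> S"
begin

lemma S_carrier: "x \<in> S \<Longrightarrow> x \<in> carrier A"
  using sub by blast

lemmas tr_simps = transported_simps[OF inj, where A = A]

lemma tr_rle: "\<lbrakk>x \<in> S; y \<in> S\<rbrakk> \<Longrightarrow> rle (transported f S A) (f x) (f y) \<longleftrightarrow> rle A x y"
  by (auto simp: rle_def tr_simps S_ops inj_on_eq_iff[OF inj])

lemma tr_residuated_lattice: "residuated_lattice (transported f S A)"
proof (unfold_locales, unfold tr_simps(1), goal_cases)
  case (12 a b) then show ?case
    by (clarsimp simp: tr_simps) (metis S_carrier rmeet_comm)
next
  case (13 a b) then show ?case
    by (clarsimp simp: tr_simps) (metis S_carrier rjoin_comm)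
next
  case (14 a b) then show ?case by (auto simp: tr_simps S_ops rmeet_absorb S_carrier)
next
  case (15 a b) then show ?case by (auto simp: tr_simps S_ops rjoin_absorb S_carrier)
next
  case (16 a b c) then show ?case by (auto simp: tr_simps tr_rle S_ops ldiv_residual S_carrier)
next
  case (17 a b c) then show ?case by (auto simp: tr_simps tr_rle S_ops rdiv_residual S_carrier)
qed (auto simp: tr_simps S_ops S_one S_carrier m_assoc rmeet_assoc rjoin_assoc)

lemma tr_conservative: "conservative A \<Longrightarrow> conservative (transported f S A)"
  using sub by (simp add: conservative_def tr_simps) (metis S_carrier)

lemma tr_commutative: "commutative A \<Longrightarrow> commutative (transported f S A)"
  using sub by (simp add: commutative_def tr_simps) (metis S_carrier)

lemma tr_idempotent: "idempotent A \<Longrightarrow> idempotent (transported f S A)"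
  using sub by (fastforce simp: idempotent_def tr_simps)

lemma tr_totally_ordered: "totally_ordered A \<Longrightarrow> totally_ordered (transported f S A)"
  using sub by (auto simp: totally_ordered_def tr_simps tr_rle)

lemma tr_eval_term:
  assumes "range \<rho> \<subseteq> S"
  shows "eval_term A \<rho> t \<in> S \<and> eval_term (transported f S A) (f \<circ> \<rho>) t = f (eval_term A \<rho> t)"
  using assms by (induction t) (auto simp: tr_simps S_one S_ops)

end

instance rterm :: countable
  by countable_datatype

lemma failing_equation_transfer:
  fixes A :: "'v rlat"
  assumes inf: "infinite (UNIV :: 'u set)"
    and A: "residuated_lattice A" and fails: "\<not> satisfies A e"
  obtains S and f :: "'v \<Rightarrow> 'u" where "transport A S f" "\<not> satisfies (transported f S A) e"
proof -
  from fails obtain \<rho> where \<rho>: "range \<rho> \<subseteq> carrier A"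
    and neq: "eval_term A \<rho> (fst e) \<noteq> eval_term A \<rho> (snd e)"
    by (auto simp: satisfies_def)
  define S where "S = range (eval_term A \<rho>)"
  have "countable S" unfolding S_def by (rule countable_image) (rule countableI_type)
  then obtain k :: "'v \<Rightarrow> nat" where k: "inj_on k S" by (auto simp: countable_def)
  obtain j :: "nat \<Rightarrow> 'u" where j: "inj j" using infinite_countable_subset[OF inf] by blast
  define f where "f = j \<circ> k"
  have f: "inj_on f S" unfolding f_def using k j by (simp add: comp_inj_on inj_on_subset)
  interpret residuated_lattice A by fact
  have ev: "eval_term A \<rho> t \<in> S" for t by (simp add: S_def)
  interpret transport A S f
  proof
    show "S \<subseteq> carrier A" using eval_term_closed[OF A \<rho>] by (auto simp: S_def)
    show "inj_on f S" by (fact f)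
    show "\<one>\<^bsub>A\<^esub> \<in> S" using ev[of Unit] by simp
    fix x y assume "x \<in> S" "y \<in> S"
    then obtain s t where st: "x = eval_term A \<rho> s" "y = eval_term A \<rho> t"
      by (auto simp: S_def)
    show "x \<otimes>\<^bsub>A\<^esub> y \<in> S" "rmeet A x y \<in> S" "rjoin A x y \<in> S" "ldiv A x y \<in> S" "rdiv A x y \<in> S"
      using ev[of "Mult s t"] ev[of "Meet s t"] ev[of "Join s t"] ev[of "LDiv s t"]
        ev[of "RDiv s t"] by (simp_all add: st)
  qed
  have rS: "range \<rho> \<subseteq> S" using ev[of "Var _"] by auto
  have "\<not> satisfies (transported f S A) e"
    unfolding satisfies_def
  proof
    assume "\<forall>\<rho>. range \<rho> \<subseteq> carrier (transported f S A) \<longrightarrow>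
      eval_term (transported f S A) \<rho> (fst e) = eval_term (transported f S A) \<rho> (snd e)"
    moreover have "range (f \<circ> \<rho>) \<subseteq> carrier (transported f S A)"
      using rS by (auto simp: tr_simps)
    ultimately have "f (eval_term A \<rho> (fst e)) = f (eval_term A \<rho> (snd e))"
      using tr_eval_term[OF rS] by metis
    then show False using neq f ev by (auto dest: inj_onD)
  qed
  with transport_axioms show thesis by (rule that)
qed

lemma equations_of_universe_mono:
  assumes "infinite (UNIV :: 'u set)"
  shows "equations_of (conservative_rls :: 'u rlat set)
           \<subseteq> equations_of (conservative_rls :: 'v rlat set)"
    and "equations_of (commutative_conservative_rls :: 'u rlat set)
           \<subseteq> equations_of (commutative_conservative_rls :: 'v rlat set)"
    and "equations_of (totally_ordered_idempotent_rls :: 'u rlat set)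
           \<subseteq> equations_of (totally_ordered_idempotent_rls :: 'v rlat set)"
  unfolding equations_of_def conservative_rls_def commutative_conservative_rls_def
    totally_ordered_idempotent_rls_def
  using failing_equation_transfer[OF assms] transport.tr_residuated_lattice
    transport.tr_conservative transport.tr_commutative transport.tr_idempotent
    transport.tr_totally_ordered
  by (smt (verit) mem_Collect_eq subsetI)+

end

theory Submission
  imports Defs
begin

text \<open>
  Each of the three classes \<open>K\<close> is defined by positive clauses, so every member of the variety
  generated by \<open>K\<close> is a subdirect product of members of \<open>K\<close>: if all iterated conjugates of
  \<open>u\<close> and of \<open>v\<close> join to the unit (which \<open>K\<close> expresses by equations), then a normal filter
  of the negative cone that is maximal among those omitting a given element contains \<open>u\<close> or \<open>v\<close>.
  A finite subset is therefore separated by finitely many homomorphisms into \<open>K\<close>, and it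
  remains to embed finite subsets \<open>B\<close> of conservative residuated lattices (idempotent chains are
  conservative). There \<open>a \<or> b\<close> is one of \<open>a\<close>, \<open>b\<close>, \<open>e \<or> a\<close>, \<open>e \<or> b\<close> and the positive cone is a chain, so
  \<open>B\<close>, \<open>e\<close> and all \<open>e \<or> b\<close> form a finite join-subsemilattice, which is a submonoid by conservativity.
  A new bottom element turns it into a finite residuated lattice, and meets and residuals that
  lie in \<open>B\<close> are preserved because they are greatest elements.
\<close>

section \<open>Normal filters of the negative cone\<close>

text \<open>The tag \<open>True\<close> gives the left conjugate of \<open>x\<close> by
  \<open>snd p\<close>, the tag \<open>False\<close> the right one, both cut down to the negative
  cone. With the tag, one list of pairs encodes any composition of the two kinds.\<close>

definition conjugate :: "'a rlat \<Rightarrow> bool \<times> 'a \<Rightarrow> 'a \<Rightarrow> 'a" where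
  "conjugate A p x = rmeet A
     (if fst p then ldiv A (snd p) (x \<otimes>\<^bsub>A\<^esub> snd p) else rdiv A (snd p \<otimes>\<^bsub>A\<^esub> x) (snd p)) \<one>\<^bsub>A\<^esub>"

definition iterated_conjugate :: "'a rlat \<Rightarrow> (bool \<times> 'a) list \<Rightarrow> 'a \<Rightarrow> 'a" where
  "iterated_conjugate A ps x = foldr (conjugate A) ps x"

context residuated_lattice
begin

abbreviation le (infix \<open>\<^bold>\<le>\<close> 50) where "x \<^bold>\<le> y \<equiv> rle A x y"
abbreviation meet (infixl \<open>\<^bold>\<and>\<close> 66) where "x \<^bold>\<and> y \<equiv> rmeet A x y"
abbreviation join (infixl \<open>\<^bold>\<or>\<close> 65) where "x \<^bold>\<or> y \<equiv> rjoin A x y"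

lemmas closed [simp, intro] = rmeet_closed rjoin_closed ldiv_closed rdiv_closed

section \<open>Order, lattice and monotonicity laws\<close>

lemma le_iff_join:
  assumes "x \<in> carrier A" "y \<in> carrier A"
  shows "x \<^bold>\<le> y \<longleftrightarrow> x \<^bold>\<or> y = y"
  using assms unfolding rle_def
  by (metis rjoin_absorb rjoin_comm rmeet_absorb rmeet_comm)

lemma meet_idem: "x \<in> carrier A \<Longrightarrow> x \<^bold>\<and> x = x"
  by (metis rmeet_absorb rjoin_absorb rmeet_closed)

lemma le_refl [simp, intro]: "x \<in> carrier A \<Longrightarrow> x \<^bold>\<le> x"
  by (simp add: rle_def meet_idem)

lemma le_antisym:
  "\<lbrakk>x \<^bold>\<le> y; y \<^bold>\<le> x; x \<in> carrier A; y \<in> carrier A\<rbrakk> \<Longrightarrow> x = y"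
  by (metis rle_def rmeet_comm)

lemma le_trans [trans]:
  "\<lbrakk>x \<^bold>\<le> y; y \<^bold>\<le> z; x \<in> carrier A; y \<in> carrier A; z \<in> carrier A\<rbrakk> \<Longrightarrow> x \<^bold>\<le> z"
  by (metis rle_def rmeet_assoc)

lemma meet_le1 [simp]: "\<lbrakk>x \<in> carrier A; y \<in> carrier A\<rbrakk> \<Longrightarrow> x \<^bold>\<and> y \<^bold>\<le> x"
  by (metis rle_def meet_idem rmeet_assoc rmeet_comm)

lemma meet_le2 [simp]: "\<lbrakk>x \<in> carrier A; y \<in> carrier A\<rbrakk> \<Longrightarrow> x \<^bold>\<and> y \<^bold>\<le> y"
  by (metis meet_le1 rmeet_comm)

lemma le_meet_iff:
  assumes "x \<in> carrier A" "y \<in> carrier A" "z \<in> carrier A"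
  shows "z \<^bold>\<le> x \<^bold>\<and> y \<longleftrightarrow> z \<^bold>\<le> x \<and> z \<^bold>\<le> y"
proof
  assume "z \<^bold>\<le> x \<^bold>\<and> y"
  then show "z \<^bold>\<le> x \<and> z \<^bold>\<le> y"
    using assms by (meson meet_le1 meet_le2 le_trans rmeet_closed)
next
  assume "z \<^bold>\<le> x \<and> z \<^bold>\<le> y"
  then show "z \<^bold>\<le> x \<^bold>\<and> y"
    using assms by (simp add: rle_def flip: rmeet_assoc)
qed

lemma join_ge1 [simp]: "\<lbrakk>x \<in> carrier A; y \<in> carrier A\<rbrakk> \<Longrightarrow> x \<^bold>\<le> x \<^bold>\<or> y"
  by (simp add: rle_def rmeet_absorb)

lemma join_ge2 [simp]: "\<lbrakk>x \<in> carrier A; y \<in> carrier A\<rbrakk> \<Longrightarrow> y \<^bold>\<le> x \<^bold>\<or> y"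
  by (metis join_ge1 rjoin_comm)

lemma join_le_iff:
  assumes "x \<in> carrier A" "y \<in> carrier A" "z \<in> carrier A"
  shows "x \<^bold>\<or> y \<^bold>\<le> z \<longleftrightarrow> x \<^bold>\<le> z \<and> y \<^bold>\<le> z"
proof
  assume "x \<^bold>\<or> y \<^bold>\<le> z"
  then show "x \<^bold>\<le> z \<and> y \<^bold>\<le> z"
    using assms by (meson join_ge1 join_ge2 le_trans rjoin_closed)
next
  assume "x \<^bold>\<le> z \<and> y \<^bold>\<le> z"
  then show "x \<^bold>\<or> y \<^bold>\<le> z"
    using assms by (simp add: le_iff_join rjoin_assoc)
qed

text \<open>Comparing upper bounds suits joins and products, whose upper bounds are governed by
  \<open>join_le_iff\<close> and by the residuals.\<close>

lemma le_eqI: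
  assumes "x \<in> carrier A" "y \<in> carrier A" "\<And>z. z \<in> carrier A \<Longrightarrow> x \<^bold>\<le> z \<longleftrightarrow> y \<^bold>\<le> z"
  shows "x = y"
  using assms by (meson le_antisym le_refl)

lemma mult_mono_left:
  assumes "x \<^bold>\<le> y" "x \<in> carrier A" "y \<in> carrier A" "z \<in> carrier A"
  shows "z \<otimes>\<^bsub>A\<^esub> x \<^bold>\<le> z \<otimes>\<^bsub>A\<^esub> y"
proof -
  have "y \<^bold>\<le> ldiv A z (z \<otimes>\<^bsub>A\<^esub> y)" using assms by (simp add: ldiv_residual)
  then show ?thesis
    using assms le_trans[of x y "ldiv A z (z \<otimes>\<^bsub>A\<^esub> y)"] by (simp add: ldiv_residual)
qed

lemma mult_mono_right:
  assumes "x \<^bold>\<le> y" "x \<in> carrier A" "y \<in> carrier A" "z \<in> carrier A"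
  shows "x \<otimes>\<^bsub>A\<^esub> z \<^bold>\<le> y \<otimes>\<^bsub>A\<^esub> z"
proof -
  have "y \<^bold>\<le> rdiv A (y \<otimes>\<^bsub>A\<^esub> z) z" using assms by (simp add: rdiv_residual)
  then show ?thesis
    using assms le_trans[of x y "rdiv A (y \<otimes>\<^bsub>A\<^esub> z) z"] by (simp add: rdiv_residual)
qed

lemma mult_mono:
  assumes "x \<^bold>\<le> y" "x' \<^bold>\<le> y'" "x \<in> carrier A" "y \<in> carrier A" "x' \<in> carrier A" "y' \<in> carrier A"
  shows "x \<otimes>\<^bsub>A\<^esub> x' \<^bold>\<le> y \<otimes>\<^bsub>A\<^esub> y'"
  using assms by (meson le_trans m_closed mult_mono_left mult_mono_right)

text \<open>Multiplication by \<open>z\<close> has the residual as right adjoint, so it preserves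
  joins: both sides have the same upper bounds.\<close>

lemma mult_join_distrib_left:
  assumes "x \<in> carrier A" "y \<in> carrier A" "z \<in> carrier A"
  shows "z \<otimes>\<^bsub>A\<^esub> (x \<^bold>\<or> y) = z \<otimes>\<^bsub>A\<^esub> x \<^bold>\<or> z \<otimes>\<^bsub>A\<^esub> y"
  by (rule le_eqI) (use assms in \<open>simp_all add: join_le_iff flip: ldiv_residual\<close>)

lemma mult_join_distrib_right:
  assumes "x \<in> carrier A" "y \<in> carrier A" "z \<in> carrier A"
  shows "(x \<^bold>\<or> y) \<otimes>\<^bsub>A\<^esub> z = x \<otimes>\<^bsub>A\<^esub> z \<^bold>\<or> y \<otimes>\<^bsub>A\<^esub> z"
  by (rule le_eqI) (use assms in \<open>simp_all add: join_le_iff flip: rdiv_residual\<close>)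

lemma mult_ldiv_le: "\<lbrakk>a \<in> carrier A; c \<in> carrier A\<rbrakk> \<Longrightarrow> a \<otimes>\<^bsub>A\<^esub> ldiv A a c \<^bold>\<le> c"
  by (simp flip: ldiv_residual)

lemma rdiv_mult_le: "\<lbrakk>b \<in> carrier A; c \<in> carrier A\<rbrakk> \<Longrightarrow> rdiv A c b \<otimes>\<^bsub>A\<^esub> b \<^bold>\<le> c"
  by (simp flip: rdiv_residual)

section \<open>The negative cone and conjugates\<close>

definition neg_cone :: "'a set" where
  "neg_cone = {x \<in> carrier A. x \<^bold>\<le> \<one>\<^bsub>A\<^esub>}"

lemma neg_coneI [intro]: "\<lbrakk>x \<in> carrier A; x \<^bold>\<le> \<one>\<^bsub>A\<^esub>\<rbrakk> \<Longrightarrow> x \<in> neg_cone"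
  by (simp add: neg_cone_def)

lemma neg_coneD: "x \<in> neg_cone \<Longrightarrow> x \<in> carrier A" "x \<in> neg_cone \<Longrightarrow> x \<^bold>\<le> \<one>\<^bsub>A\<^esub>"
  by (simp_all add: neg_cone_def)

lemma one_neg [simp, intro]: "\<one>\<^bsub>A\<^esub> \<in> neg_cone"
  by auto

lemma neg_mult_le:
  assumes "x \<in> neg_cone" "y \<in> carrier A"
  shows "x \<otimes>\<^bsub>A\<^esub> y \<^bold>\<le> y" "y \<otimes>\<^bsub>A\<^esub> x \<^bold>\<le> y"
  using mult_mono_right[of x "\<one>\<^bsub>A\<^esub>" y] mult_mono_left[of x "\<one>\<^bsub>A\<^esub>" y] assms
  by (simp_all add: neg_coneD)

lemma neg_mult_closed: "\<lbrakk>x \<in> neg_cone; y \<in> neg_cone\<rbrakk> \<Longrightarrow> x \<otimes>\<^bsub>A\<^esub> y \<in> neg_cone"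
  using neg_mult_le(1)[of x y] le_trans[of "x \<otimes>\<^bsub>A\<^esub> y" y "\<one>\<^bsub>A\<^esub>"] by (auto simp: neg_coneD)

lemma conjugate_neg: "\<lbrakk>x \<in> carrier A; snd p \<in> carrier A\<rbrakk> \<Longrightarrow> conjugate A p x \<in> neg_cone"
  by (auto simp: conjugate_def)

text \<open>For negative \<open>y\<close> the meet with the unit inside a conjugate is no
  restriction, so residuation alone decides. A conjugate is thus the largest negative solution of
  its inequality.\<close>

lemma le_conjugate_iff:
  assumes "x \<in> carrier A" "a \<in> carrier A" "y \<in> neg_cone"
  shows "y \<^bold>\<le> conjugate A (True, a) x \<longleftrightarrow> a \<otimes>\<^bsub>A\<^esub> y \<^bold>\<le> x \<otimes>\<^bsub>A\<^esub> a"
    and "y \<^bold>\<le> conjugate A (False, a) x \<longleftrightarrow> y \<otimes>\<^bsub>A\<^esub> a \<^bold>\<le> a \<otimes>\<^bsub>A\<^esub> x"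
  using assms
  by (simp_all add: conjugate_def le_meet_iff neg_coneD ldiv_residual rdiv_residual)

text \<open>An element is passed to the other side of \<open>a\<close> at the price of a conjugation
  and an inequality. In what follows this stands in for commutativity.\<close>

lemma conjugate_swap:
  assumes "x \<in> carrier A" "a \<in> carrier A"
  shows "a \<otimes>\<^bsub>A\<^esub> conjugate A (True, a) x \<^bold>\<le> x \<otimes>\<^bsub>A\<^esub> a"
    and "conjugate A (False, a) x \<otimes>\<^bsub>A\<^esub> a \<^bold>\<le> a \<otimes>\<^bsub>A\<^esub> x"
  using assms conjugate_neg[of x "(_, a)"]
  by (simp_all flip: le_conjugate_iff add: neg_coneD)

lemma conjugate_one: "snd p \<in> carrier A \<Longrightarrow> conjugate A p \<one>\<^bsub>A\<^esub> = \<one>\<^bsub>A\<^esub>"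
proof -
  assume p: "snd p \<in> carrier A"
  have "\<one>\<^bsub>A\<^esub> \<^bold>\<le> conjugate A p \<one>\<^bsub>A\<^esub>"
    using p by (cases p; cases "fst p") (auto simp: le_conjugate_iff)
  then show ?thesis
    using p conjugate_neg[of "\<one>\<^bsub>A\<^esub>" p] by (auto simp: neg_coneD intro: le_antisym)
qed

lemma conjugate_mono:
  assumes "x \<^bold>\<le> y" "x \<in> carrier A" "y \<in> carrier A" "snd p \<in> carrier A"
  shows "conjugate A p x \<^bold>\<le> conjugate A p y"
proof (cases p)
  case (Pair l a)
  then have a: "a \<in> carrier A" using assms by simp
  note n = conjugate_neg[of x "(_, a)", simplified, OF assms(2) a]
  have "a \<otimes>\<^bsub>A\<^esub> conjugate A (True, a) x \<^bold>\<le> y \<otimes>\<^bsub>A\<^esub> a"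
    "conjugate A (False, a) x \<otimes>\<^bsub>A\<^esub> a \<^bold>\<le> a \<otimes>\<^bsub>A\<^esub> y"
    using conjugate_swap[of x a] mult_mono_right[of x y a] mult_mono_left[of x y a] assms a
      n[THEN neg_coneD(1)]
    by (meson le_trans m_closed)+
  then show ?thesis
    using assms a n Pair by (cases l) (simp_all add: le_conjugate_iff)
qed

text \<open>The factor \<open>a\<close> is moved past the two conjugates one after the other by
  \<open>conjugate_swap\<close>; \<open>le_conjugate_iff\<close> then turns the result into the
  bound.\<close>

lemma conjugate_mult:
  assumes "x \<in> carrier A" "y \<in> carrier A" "snd p \<in> carrier A"
  shows "conjugate A p x \<otimes>\<^bsub>A\<^esub> conjugate A p y \<^bold>\<le> conjugate A p (x \<otimes>\<^bsub>A\<^esub> y)"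
proof (cases p)
  case (Pair l a)
  then have a: "a \<in> carrier A" using assms by simp
  define cx where "cx l = conjugate A (l, a) x" for l
  define cy where "cy l = conjugate A (l, a) y" for l
  have n: "cx l \<in> neg_cone" "cy l \<in> neg_cone" for l
    using assms a by (simp_all add: cx_def cy_def conjugate_neg)
  note c = n[THEN neg_coneD(1)]
  have "a \<otimes>\<^bsub>A\<^esub> (cx True \<otimes>\<^bsub>A\<^esub> cy True) \<^bold>\<le> x \<otimes>\<^bsub>A\<^esub> a \<otimes>\<^bsub>A\<^esub> cy True"
    using mult_mono_right[OF conjugate_swap(1)[OF assms(1) a], of "cy True"] assms a c
    by (simp add: cx_def[symmetric] m_assoc)
  also have "\<dots> \<^bold>\<le> (x \<otimes>\<^bsub>A\<^esub> y) \<otimes>\<^bsub>A\<^esub> a"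
    using mult_mono_left[OF conjugate_swap(1)[OF assms(2) a], of x] assms a c
    by (simp add: cy_def[symmetric] m_assoc)
  finally have 1: "a \<otimes>\<^bsub>A\<^esub> (cx True \<otimes>\<^bsub>A\<^esub> cy True) \<^bold>\<le> (x \<otimes>\<^bsub>A\<^esub> y) \<otimes>\<^bsub>A\<^esub> a"
    using assms a c by simp
  have "(cx False \<otimes>\<^bsub>A\<^esub> cy False) \<otimes>\<^bsub>A\<^esub> a \<^bold>\<le> cx False \<otimes>\<^bsub>A\<^esub> (a \<otimes>\<^bsub>A\<^esub> y)"
    using mult_mono_left[OF conjugate_swap(2)[OF assms(2) a], of "cx False"] assms a c
    by (simp add: cy_def[symmetric] m_assoc)
  also have "\<dots> \<^bold>\<le> a \<otimes>\<^bsub>A\<^esub> (x \<otimes>\<^bsub>A\<^esub> y)"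
    using mult_mono_right[OF conjugate_swap(2)[OF assms(1) a], of y] assms a c
    by (simp add: cx_def[symmetric] m_assoc)
  finally have 2: "(cx False \<otimes>\<^bsub>A\<^esub> cy False) \<otimes>\<^bsub>A\<^esub> a \<^bold>\<le> a \<otimes>\<^bsub>A\<^esub> (x \<otimes>\<^bsub>A\<^esub> y)"
    using assms a c by simp
  from 1 2 show ?thesis
    unfolding Pair cx_def[symmetric] cy_def[symmetric]
    by (cases l) (use assms a n in \<open>simp_all add: le_conjugate_iff neg_mult_closed\<close>)
qed

section \<open>Iterated conjugates, orthogonality and normal filters\<close>

lemma iterated_conjugate_neg:
  assumes "x \<in> neg_cone" "snd ` set ps \<subseteq> carrier A"
  shows "iterated_conjugate A ps x \<in> neg_cone"
  using assms(2)
  by (induction ps) (auto simp: iterated_conjugate_def assms intro!: conjugate_neg neg_coneD(1))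

lemma iterated_conjugate_one:
  "snd ` set ps \<subseteq> carrier A \<Longrightarrow> iterated_conjugate A ps \<one>\<^bsub>A\<^esub> = \<one>\<^bsub>A\<^esub>"
  by (induction ps) (auto simp: iterated_conjugate_def conjugate_one)

text \<open>This is a family of equations with parameters, so it passes from a class to the variety
  it generates. For negative \<open>u\<close> and \<open>v\<close> it makes the normal filters
  generated by them meet only in the unit.\<close>

definition orthogonal :: "'a \<Rightarrow> 'a \<Rightarrow> bool" where
  "orthogonal u v \<longleftrightarrow> (\<forall>ps qs. snd ` set ps \<subseteq> carrier A \<longrightarrow> snd ` set qs \<subseteq> carrier A \<longrightarrow>
     iterated_conjugate A ps u \<^bold>\<or> iterated_conjugate A qs v = \<one>\<^bsub>A\<^esub>)"

lemma neg_join_one: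
  assumes "x \<in> neg_cone"
  shows "\<one>\<^bsub>A\<^esub> \<^bold>\<or> x = \<one>\<^bsub>A\<^esub>" "x \<^bold>\<or> \<one>\<^bsub>A\<^esub> = \<one>\<^bsub>A\<^esub>"
proof -
  show "x \<^bold>\<or> \<one>\<^bsub>A\<^esub> = \<one>\<^bsub>A\<^esub>"
    using assms by (simp add: neg_coneD flip: le_iff_join)
  then show "\<one>\<^bsub>A\<^esub> \<^bold>\<or> x = \<one>\<^bsub>A\<^esub>"
    using assms by (simp add: neg_coneD rjoin_comm)
qed

text \<open>Conjugation fixes the unit, so one side of each join is the unit and the other is
  negative. In this way a disjunction valid in a class becomes orthogonality.\<close>

lemma orthogonal_one:
  assumes "u \<in> neg_cone" "v \<in> neg_cone" "u = \<one>\<^bsub>A\<^esub> \<or> v = \<one>\<^bsub>A\<^esub>"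
  shows "orthogonal u v"
  using assms unfolding orthogonal_def
  by (auto simp: iterated_conjugate_one iterated_conjugate_neg neg_join_one)

text \<open>The convex normal submonoids of the negative cone, which correspond to the congruences
  of \<open>A\<close>; closure under conjugates is normality.\<close>

definition normal_filter :: "'a set \<Rightarrow> bool" where
  "normal_filter F \<longleftrightarrow> F \<subseteq> neg_cone \<and> \<one>\<^bsub>A\<^esub> \<in> F \<and> (\<forall>x\<in>F. \<forall>y\<in>F. x \<otimes>\<^bsub>A\<^esub> y \<in> F) \<and>
     (\<forall>x\<in>F. \<forall>y\<in>neg_cone. x \<^bold>\<le> y \<longrightarrow> y \<in> F) \<and>
     (\<forall>x\<in>F. \<forall>p. snd p \<in> carrier A \<longrightarrow> conjugate A p x \<in> F)"

lemma normal_filterD: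
  assumes "normal_filter F"
  shows "x \<in> F \<Longrightarrow> x \<in> neg_cone" "\<one>\<^bsub>A\<^esub> \<in> F" "\<lbrakk>x \<in> F; y \<in> F\<rbrakk> \<Longrightarrow> x \<otimes>\<^bsub>A\<^esub> y \<in> F"
    "\<lbrakk>x \<in> F; x \<^bold>\<le> y; y \<in> neg_cone\<rbrakk> \<Longrightarrow> y \<in> F"
    "\<lbrakk>x \<in> F; snd p \<in> carrier A\<rbrakk> \<Longrightarrow> conjugate A p x \<in> F"
  using assms unfolding normal_filter_def by blast+

text \<open>For negative \<open>u\<close>, the negative elements above such products form the normal
  filter generated by \<open>u\<close>. Adding one conjugate on the left at a time gives a shape
  suited to induction.\<close>

inductive_set conjugate_products :: "'a \<Rightarrow> 'a set" for u where
  one: "\<one>\<^bsub>A\<^esub> \<in> conjugate_products u"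
| step: "\<lbrakk>snd ` set ps \<subseteq> carrier A; w \<in> conjugate_products u\<rbrakk>
    \<Longrightarrow> iterated_conjugate A ps u \<otimes>\<^bsub>A\<^esub> w \<in> conjugate_products u"

lemma conjugate_products_neg:
  assumes "u \<in> neg_cone" "w \<in> conjugate_products u"
  shows "w \<in> neg_cone"
  using assms(2)
  by induction (auto simp: assms(1) iterated_conjugate_neg neg_mult_closed)

lemma conjugate_products_mult:
  assumes "u \<in> neg_cone" "w \<in> conjugate_products u" "w' \<in> conjugate_products u"
  shows "w \<otimes>\<^bsub>A\<^esub> w' \<in> conjugate_products u"
  using assms(2)
proof induction
  case one
  then show ?case using assms by (simp add: conjugate_products_neg neg_coneD)
next
  case (step ps w)
  then have "iterated_conjugate A ps u \<otimes>\<^bsub>A\<^esub> (w \<otimes>\<^bsub>A\<^esub> w') \<in> conjugate_products u"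
    by (simp add: conjugate_products.step)
  then show ?case
    using step assms
    by (simp add: m_assoc iterated_conjugate_neg conjugate_products_neg neg_coneD)
qed

text \<open>By \<open>conjugate_mult\<close> the factors may be conjugated separately, and
  conjugating an iterated conjugate by \<open>p\<close> only prefixes \<open>p\<close> to its
  list.\<close>

lemma conjugate_products_conjugate:
  assumes "u \<in> neg_cone" "w \<in> conjugate_products u" "snd p \<in> carrier A"
  shows "\<exists>w'\<in>conjugate_products u. w' \<^bold>\<le> conjugate A p w"
  using assms(2)
proof induction
  case one
  then show ?case using assms conjugate_products.one by (auto simp: conjugate_one)
next
  case (step ps w)
  then obtain w' where w': "w' \<in> conjugate_products u" "w' \<^bold>\<le> conjugate A p w" by blast
  let ?c = "iterated_conjugate A ps u"
  have c: "?c \<in> carrier A" using step assms by (simp add: iterated_conjugate_neg neg_coneD)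
  have w: "w \<in> carrier A" "w' \<in> carrier A"
    using step w' assms by (simp_all add: conjugate_products_neg neg_coneD)
  have n: "conjugate A p x \<in> carrier A" if "x \<in> carrier A" for x
    using that assms by (simp add: conjugate_neg neg_coneD)
  have "iterated_conjugate A (p # ps) u \<otimes>\<^bsub>A\<^esub> w' \<in> conjugate_products u"
    using step w' assms by (intro conjugate_products.step) auto
  moreover have "iterated_conjugate A (p # ps) u \<otimes>\<^bsub>A\<^esub> w' \<^bold>\<le> conjugate A p (?c \<otimes>\<^bsub>A\<^esub> w)"
    using mult_mono_left[OF w'(2), of "conjugate A p ?c"] conjugate_mult[of ?c w p] c w n assms
    by (simp add: iterated_conjugate_def) (meson le_trans m_closed)
  ultimately show ?case by blast
qed

text \<open>Expand the unit as the product of the two joins: as the factors are negative, every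
  summand except the product of \<open>y\<close> and \<open>z\<close> lies below
  \<open>x\<close>.\<close>

lemma join_mult_eq_one:
  assumes "x \<in> neg_cone" "y \<in> neg_cone" "z \<in> neg_cone" "x \<^bold>\<or> y = \<one>\<^bsub>A\<^esub>" "x \<^bold>\<or> z = \<one>\<^bsub>A\<^esub>"
  shows "x \<^bold>\<or> y \<otimes>\<^bsub>A\<^esub> z = \<one>\<^bsub>A\<^esub>"
proof -
  note c = assms(1-3)[THEN neg_coneD(1)]
  have xz: "x \<otimes>\<^bsub>A\<^esub> \<one>\<^bsub>A\<^esub> \<^bold>\<le> x" "y \<otimes>\<^bsub>A\<^esub> x \<^bold>\<le> x"
    using assms c by (simp_all add: neg_mult_le)
  have "\<one>\<^bsub>A\<^esub> = (x \<^bold>\<or> y) \<otimes>\<^bsub>A\<^esub> (x \<^bold>\<or> z)" using assms by simp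
  also have "\<dots> = x \<otimes>\<^bsub>A\<^esub> (x \<^bold>\<or> z) \<^bold>\<or> (y \<otimes>\<^bsub>A\<^esub> x \<^bold>\<or> y \<otimes>\<^bsub>A\<^esub> z)"
    using c by (simp add: mult_join_distrib_right[of x y "x \<^bold>\<or> z"] mult_join_distrib_left[of x z y])
  also have "\<dots> = x \<^bold>\<or> (y \<otimes>\<^bsub>A\<^esub> x \<^bold>\<or> y \<otimes>\<^bsub>A\<^esub> z)" using assms c by simp
  also have "\<dots> = x \<^bold>\<or> y \<otimes>\<^bsub>A\<^esub> z"
    using xz(2) c by (simp add: le_iff_join rjoin_comm[of x] flip: rjoin_assoc)
  finally show ?thesis by simp
qed

text \<open>Two nested inductions, each step being \<open>join_mult_eq_one\<close>: the inner one
  builds \<open>w\<close> against a single conjugate of \<open>v\<close>, the outer one builds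
  \<open>w'\<close>.\<close>

lemma orthogonal_conjugate_products:
  assumes "orthogonal u v" "u \<in> neg_cone" "v \<in> neg_cone"
    and "w \<in> conjugate_products u" "w' \<in> conjugate_products v"
  shows "w \<^bold>\<or> w' = \<one>\<^bsub>A\<^esub>"
  using assms(5)
proof induction
  case one
  then show ?case using assms by (simp add: neg_join_one conjugate_products_neg)
next
  case (step qs w')
  let ?d = "iterated_conjugate A qs v"
  have d: "?d \<in> neg_cone" using step assms by (simp add: iterated_conjugate_neg)
  have qs: "snd ` set qs \<subseteq> carrier A" by fact
  have "w \<^bold>\<or> ?d = \<one>\<^bsub>A\<^esub>"
    using assms(4)
  proof induction
    case one
    then show ?case using d by (simp add: neg_join_one)
  next
    case (step ps w)
    let ?c = "iterated_conjugate A ps u"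
    have cw: "?c \<in> neg_cone" "w \<in> neg_cone"
      using step assms by (simp_all add: iterated_conjugate_neg conjugate_products_neg)
    have "?d \<^bold>\<or> ?c \<otimes>\<^bsub>A\<^esub> w = \<one>\<^bsub>A\<^esub>"
    proof (rule join_mult_eq_one)
      show "?d \<^bold>\<or> ?c = \<one>\<^bsub>A\<^esub>"
        using step qs assms(1) cw d by (metis orthogonal_def rjoin_comm neg_coneD(1))
      show "?d \<^bold>\<or> w = \<one>\<^bsub>A\<^esub>" using step cw d by (metis rjoin_comm neg_coneD(1))
    qed (use cw d in auto)
    then show ?case using cw d by (metis rjoin_comm neg_coneD(1) neg_mult_closed)
  qed
  then show ?case
    using join_mult_eq_one[of w ?d w'] d step assms by (simp add: conjugate_products_neg)
qed

text \<open>\<open>G\<close> is the normal filter generated by \<open>F\<close> and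
  \<open>u\<close>. Normality of \<open>F\<close> lets all its factors be collected on the left, so
  products of one \<open>f\<close> and one \<open>w\<close> are enough.\<close>

lemma normal_filter_adjoin:
  assumes F: "normal_filter F" and u: "u \<in> neg_cone"
  defines "G \<equiv> {x \<in> neg_cone. \<exists>f\<in>F. \<exists>w\<in>conjugate_products u. f \<otimes>\<^bsub>A\<^esub> w \<^bold>\<le> x}"
  shows "normal_filter G" "F \<subseteq> G" "u \<in> G"
proof -
  have Fn: "f \<in> neg_cone" if "f \<in> F" for f using F that by (auto simp: normal_filter_def)
  note Fc = Fn[THEN neg_coneD(1)]
  have wn: "w \<in> neg_cone" if "w \<in> conjugate_products u" for w
    using conjugate_products_neg u that .
  note wc = wn[THEN neg_coneD(1)]
  show FG: "F \<subseteq> G"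
  proof
    fix f assume "f \<in> F"
    then have "f \<otimes>\<^bsub>A\<^esub> \<one>\<^bsub>A\<^esub> \<^bold>\<le> f" using Fc by simp
    then show "f \<in> G"
      unfolding G_def using \<open>f \<in> F\<close> Fn conjugate_products.one by blast
  qed
  have "u \<in> conjugate_products u"
    using conjugate_products.step[of "[]" "\<one>\<^bsub>A\<^esub>" u] u conjugate_products.one
    by (simp add: iterated_conjugate_def neg_coneD)
  moreover have "\<one>\<^bsub>A\<^esub> \<in> F" using F by (simp add: normal_filter_def)
  moreover have "\<one>\<^bsub>A\<^esub> \<otimes>\<^bsub>A\<^esub> u \<^bold>\<le> u" using u by (simp add: neg_coneD)
  ultimately show "u \<in> G"
    unfolding G_def using u by blast
  show "normal_filter G"
    unfolding normal_filter_def
  proof (intro conjI ballI allI impI)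
    show "G \<subseteq> neg_cone" by (auto simp: G_def)
    show "\<one>\<^bsub>A\<^esub> \<in> G" using FG \<open>\<one>\<^bsub>A\<^esub> \<in> F\<close> by blast
  next
    fix x y assume "x \<in> G" "y \<in> G"
    then obtain f w g w' where *: "f \<in> F" "w \<in> conjugate_products u" "f \<otimes>\<^bsub>A\<^esub> w \<^bold>\<le> x"
      "g \<in> F" "w' \<in> conjugate_products u" "g \<otimes>\<^bsub>A\<^esub> w' \<^bold>\<le> y" and xy: "x \<in> neg_cone" "y \<in> neg_cone"
      by (auto simp: G_def)
    note c = Fc[OF *(1)] Fc[OF *(4)] wc[OF *(2)] wc[OF *(5)] xy[THEN neg_coneD(1)]
    \<comment> \<open>In the product of \<open>f\<close>, \<open>w\<close>, \<open>g\<close>,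
      \<open>w'\<close> the factor \<open>g\<close> must move left past \<open>w\<close>. Its right
      conjugate by \<open>w\<close> can do so, and it stays in \<open>F\<close>.\<close>
    let ?g = "conjugate A (False, w) g"
    have g: "?g \<in> F" using F * c by (simp add: normal_filter_def)
    have "(f \<otimes>\<^bsub>A\<^esub> ?g) \<otimes>\<^bsub>A\<^esub> (w \<otimes>\<^bsub>A\<^esub> w') = f \<otimes>\<^bsub>A\<^esub> ((?g \<otimes>\<^bsub>A\<^esub> w) \<otimes>\<^bsub>A\<^esub> w')"
      using c Fc[OF g] by (simp add: m_assoc)
    also have "\<dots> \<^bold>\<le> f \<otimes>\<^bsub>A\<^esub> ((w \<otimes>\<^bsub>A\<^esub> g) \<otimes>\<^bsub>A\<^esub> w')"
      using c Fc[OF g] by (intro mult_mono_left mult_mono_right conjugate_swap) auto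
    also have "\<dots> = (f \<otimes>\<^bsub>A\<^esub> w) \<otimes>\<^bsub>A\<^esub> (g \<otimes>\<^bsub>A\<^esub> w')" using c by (simp add: m_assoc)
    also have "\<dots> \<^bold>\<le> x \<otimes>\<^bsub>A\<^esub> y" using c * by (intro mult_mono) auto
    finally have "(f \<otimes>\<^bsub>A\<^esub> ?g) \<otimes>\<^bsub>A\<^esub> (w \<otimes>\<^bsub>A\<^esub> w') \<^bold>\<le> x \<otimes>\<^bsub>A\<^esub> y" using c Fc[OF g] by auto
    moreover have "f \<otimes>\<^bsub>A\<^esub> ?g \<in> F" using F g * by (simp add: normal_filter_def)
    moreover have "w \<otimes>\<^bsub>A\<^esub> w' \<in> conjugate_products u" using conjugate_products_mult u * by blast
    ultimately show "x \<otimes>\<^bsub>A\<^esub> y \<in> G" unfolding G_def using neg_mult_closed xy by blast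
  next
    fix x y assume "x \<in> G" "y \<in> neg_cone" "x \<^bold>\<le> y"
    then show "y \<in> G"
      unfolding G_def by (smt (verit) Fc wc le_trans m_closed mem_Collect_eq neg_coneD(1))
  next
    fix x and p :: "bool \<times> 'a" assume "x \<in> G" and p: "snd p \<in> carrier A"
    then obtain f w where *: "f \<in> F" "w \<in> conjugate_products u" "f \<otimes>\<^bsub>A\<^esub> w \<^bold>\<le> x" "x \<in> neg_cone"
      by (auto simp: G_def)
    note c = Fc[OF *(1)] wc[OF *(2)] neg_coneD(1)[OF *(4)]
    obtain w' where w': "w' \<in> conjugate_products u" "w' \<^bold>\<le> conjugate A p w"
      using conjugate_products_conjugate u * p by blast
    have n: "conjugate A p z \<in> carrier A" if "z \<in> carrier A" for z
      using that p by (simp add: conjugate_neg neg_coneD)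
    have "conjugate A p f \<otimes>\<^bsub>A\<^esub> w' \<^bold>\<le> conjugate A p f \<otimes>\<^bsub>A\<^esub> conjugate A p w"
      using w' wc n c by (intro mult_mono_left) auto
    also have "\<dots> \<^bold>\<le> conjugate A p (f \<otimes>\<^bsub>A\<^esub> w)" using c p by (intro conjugate_mult)
    also have "\<dots> \<^bold>\<le> conjugate A p x" using c p * by (intro conjugate_mono) auto
    finally have "conjugate A p f \<otimes>\<^bsub>A\<^esub> w' \<^bold>\<le> conjugate A p x" using c n wc w' by auto
    moreover have "conjugate A p f \<in> F" using normal_filterD(5)[OF F] * p by blast
    ultimately show "conjugate A p x \<in> G" unfolding G_def using w' conjugate_neg c p by blast
  qed
qed

text \<open>Zorn's lemma gives a normal filter that is maximal among those omitting
  \<open>p\<close>. If it omitted both members of an orthogonal pair, adjoining either would bring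
  in \<open>p\<close>, and orthogonality would put \<open>p\<close> into the filter itself.\<close>

lemma prime_filter_exists:
  assumes p: "p \<in> neg_cone" "p \<noteq> \<one>\<^bsub>A\<^esub>"
  obtains F where "normal_filter F" "p \<notin> F"
    "\<And>u v. \<lbrakk>u \<in> neg_cone; v \<in> neg_cone; orthogonal u v\<rbrakk> \<Longrightarrow> u \<in> F \<or> v \<in> F"
proof -
  let ?\<F> = "{F. normal_filter F \<and> p \<notin> F}"
  \<comment> \<open>The trivial filter makes the family for Zorn's lemma nonempty.\<close>
  have "normal_filter {\<one>\<^bsub>A\<^esub>}"
    by (auto simp: normal_filter_def conjugate_one neg_cone_def intro: le_antisym)
  then have ne: "?\<F> \<noteq> {}" using p by blast
  obtain F where F: "normal_filter F" "p \<notin> F"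
    and max: "\<And>G. \<lbrakk>normal_filter G; p \<notin> G; F \<subseteq> G\<rbrakk> \<Longrightarrow> G = F"
  proof -
    have "\<Union>C \<in> ?\<F>" if C: "C \<noteq> {}" "subset.chain ?\<F> C" for C
    proof -
      have nf: "normal_filter G" "p \<notin> G" if "G \<in> C" for G
        using C that by (auto simp: subset.chain_def)
      have 1: "\<Union>C \<subseteq> neg_cone" using nf(1) normal_filterD(1) by blast
      have 2: "\<one>\<^bsub>A\<^esub> \<in> \<Union>C" using C(1) nf(1) normal_filterD(2) by blast
      have 3: "x \<otimes>\<^bsub>A\<^esub> y \<in> \<Union>C" if "x \<in> \<Union>C" "y \<in> \<Union>C" for x y
      proof -
        from that obtain G H where GH: "x \<in> G" "G \<in> C" "y \<in> H" "H \<in> C" by blast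
        then have "G \<subseteq> H \<or> H \<subseteq> G" using C unfolding subset.chain_def by blast
        then have "\<exists>M\<in>C. x \<in> M \<and> y \<in> M" using GH by blast
        then show ?thesis using nf(1) normal_filterD(3) by blast
      qed
      have 4: "y \<in> \<Union>C" if "x \<in> \<Union>C" "y \<in> neg_cone" "x \<^bold>\<le> y" for x y
        using that nf(1) normal_filterD(4) by blast
      have 5: "conjugate A p x \<in> \<Union>C" if "x \<in> \<Union>C" "snd p \<in> carrier A" for x p
        using that nf(1) normal_filterD(5) by blast
      have "normal_filter (\<Union>C)"
        unfolding normal_filter_def
        by (intro conjI ballI allI impI 1 2) (rule 3 4 5; assumption)+
      then show ?thesis using nf by blast
    qed
    from subset_Zorn_nonempty[OF ne this] show thesis using that by blast
  qed
  have "u \<in> F \<or> v \<in> F" if uv: "u \<in> neg_cone" "v \<in> neg_cone" "orthogonal u v" for u v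
  proof (rule ccontr)
    assume "\<not> (u \<in> F \<or> v \<in> F)"
    \<comment> \<open>By maximality both adjoined filters contain \<open>p\<close>, which unfolds to
      these lower bounds of \<open>p\<close>.\<close>
    then have "\<exists>f\<in>F. \<exists>w\<in>conjugate_products u. f \<otimes>\<^bsub>A\<^esub> w \<^bold>\<le> p"
      "\<exists>f\<in>F. \<exists>w\<in>conjugate_products v. f \<otimes>\<^bsub>A\<^esub> w \<^bold>\<le> p"
      using max normal_filter_adjoin[OF F(1) uv(1)] normal_filter_adjoin[OF F(1) uv(2)] by blast+
    then obtain f w g w' where *: "f \<in> F" "w \<in> conjugate_products u" "f \<otimes>\<^bsub>A\<^esub> w \<^bold>\<le> p"
      "g \<in> F" "w' \<in> conjugate_products v" "g \<otimes>\<^bsub>A\<^esub> w' \<^bold>\<le> p" by blast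
    have n: "f \<in> neg_cone" "g \<in> neg_cone" "w \<in> neg_cone" "w' \<in> neg_cone"
      using * F(1) uv conjugate_products_neg by (auto simp: normal_filter_def)
    note c = n[THEN neg_coneD(1)] neg_coneD(1)[OF p(1)]
    have "w \<^bold>\<or> w' = \<one>\<^bsub>A\<^esub>" using orthogonal_conjugate_products uv * by blast
    then have "f \<otimes>\<^bsub>A\<^esub> g = f \<otimes>\<^bsub>A\<^esub> g \<otimes>\<^bsub>A\<^esub> (w \<^bold>\<or> w')" using c by simp
    also have "\<dots> = f \<otimes>\<^bsub>A\<^esub> (g \<otimes>\<^bsub>A\<^esub> w) \<^bold>\<or> f \<otimes>\<^bsub>A\<^esub> (g \<otimes>\<^bsub>A\<^esub> w')"
      using c by (simp add: mult_join_distrib_left m_assoc)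
    also have "\<dots> \<^bold>\<le> p"
    proof -
      have "f \<otimes>\<^bsub>A\<^esub> (g \<otimes>\<^bsub>A\<^esub> w) \<^bold>\<le> f \<otimes>\<^bsub>A\<^esub> w" "f \<otimes>\<^bsub>A\<^esub> (g \<otimes>\<^bsub>A\<^esub> w') \<^bold>\<le> g \<otimes>\<^bsub>A\<^esub> w'"
        using c n by (simp_all add: mult_mono_left neg_mult_le)
      then show ?thesis using c * by (simp add: join_le_iff) (meson le_trans m_closed)
    qed
    finally have "f \<otimes>\<^bsub>A\<^esub> g \<^bold>\<le> p" .
    moreover have "f \<otimes>\<^bsub>A\<^esub> g \<in> F" using * F(1) by (simp add: normal_filter_def)
    ultimately show False using F p unfolding normal_filter_def by blast
  qed
  with F show thesis by (rule that)
qed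

end

section \<open>Subdirect representation\<close>

definition rl_hom :: "'a rlat \<Rightarrow> 'b rlat \<Rightarrow> ('a \<Rightarrow> 'b) \<Rightarrow> bool" where
  "rl_hom A C h \<longleftrightarrow> h ` carrier A \<subseteq> carrier C \<and> h \<one>\<^bsub>A\<^esub> = \<one>\<^bsub>C\<^esub> \<and>
     (\<forall>x\<in>carrier A. \<forall>y\<in>carrier A.
        h (x \<otimes>\<^bsub>A\<^esub> y) = h x \<otimes>\<^bsub>C\<^esub> h y \<and>
        h (rmeet A x y) = rmeet C (h x) (h y) \<and> h (rjoin A x y) = rjoin C (h x) (h y) \<and>
        h (ldiv A x y) = ldiv C (h x) (h y) \<and> h (rdiv A x y) = rdiv C (h x) (h y))"

section \<open>The quotient by a normal filter\<close>

locale rl_quotient = residuated_lattice A for A :: "'a rlat" +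
  fixes F :: "'a set"
  assumes F: "normal_filter F"
begin

lemmas F_props = normal_filterD[OF F]

lemma F_carrier: "f \<in> F \<Longrightarrow> f \<in> carrier A"
  using F_props(1) neg_coneD(1) by blast

text \<open>The order of the quotient pulled back to \<open>A\<close>: elements of \<open>F\<close>
  count as the unit.\<close>

definition qle :: "'a \<Rightarrow> 'a \<Rightarrow> bool" (infix \<open>\<lesssim>\<close> 50) where
  "x \<lesssim> y \<longleftrightarrow> (\<exists>f\<in>F. f \<otimes>\<^bsub>A\<^esub> x \<^bold>\<le> y)"

text \<open>Normality makes the left and right versions of the preorder agree: the conjugate by
  \<open>x\<close> of an element of \<open>F\<close> is again in \<open>F\<close> and acts on the
  other side of \<open>x\<close>.\<close>

lemma qle_right:
  assumes "x \<in> carrier A" "y \<in> carrier A"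
  shows "x \<lesssim> y \<longleftrightarrow> (\<exists>f\<in>F. x \<otimes>\<^bsub>A\<^esub> f \<^bold>\<le> y)"
proof
  assume "x \<lesssim> y"
  then obtain f where f: "f \<in> F" "f \<otimes>\<^bsub>A\<^esub> x \<^bold>\<le> y" by (auto simp: qle_def)
  have c: "conjugate A (True, x) f \<in> F" using f assms by (simp add: F_props)
  have "x \<otimes>\<^bsub>A\<^esub> conjugate A (True, x) f \<^bold>\<le> y"
    using conjugate_swap(1)[of f x] f c assms F_carrier by (meson le_trans m_closed)
  with c show "\<exists>f\<in>F. x \<otimes>\<^bsub>A\<^esub> f \<^bold>\<le> y" by blast
next
  assume "\<exists>f\<in>F. x \<otimes>\<^bsub>A\<^esub> f \<^bold>\<le> y"
  then obtain f where f: "f \<in> F" "x \<otimes>\<^bsub>A\<^esub> f \<^bold>\<le> y" by blast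
  have c: "conjugate A (False, x) f \<in> F" using f assms by (simp add: F_props)
  have "conjugate A (False, x) f \<otimes>\<^bsub>A\<^esub> x \<^bold>\<le> y"
    using conjugate_swap(2)[of f x] f c assms F_carrier by (meson le_trans m_closed)
  with c show "x \<lesssim> y" unfolding qle_def by blast
qed

lemma le_imp_qle: "\<lbrakk>x \<^bold>\<le> y; x \<in> carrier A\<rbrakk> \<Longrightarrow> x \<lesssim> y"
  unfolding qle_def using F_props(2) by force

lemma qle_refl [simp]: "x \<in> carrier A \<Longrightarrow> x \<lesssim> x"
  by (simp add: le_imp_qle)

lemma qle_trans:
  assumes "x \<lesssim> y" "y \<lesssim> z" "x \<in> carrier A" "y \<in> carrier A" "z \<in> carrier A"
  shows "x \<lesssim> z"
proof -
  from assms obtain f g where fg: "f \<in> F" "f \<otimes>\<^bsub>A\<^esub> x \<^bold>\<le> y" "g \<in> F" "g \<otimes>\<^bsub>A\<^esub> y \<^bold>\<le> z"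
    by (auto simp: qle_def)
  have "(g \<otimes>\<^bsub>A\<^esub> f) \<otimes>\<^bsub>A\<^esub> x \<^bold>\<le> z"
    using mult_mono_left[OF fg(2), of g] fg F_carrier assms
    by (simp add: m_assoc) (meson le_trans m_closed)
  then show ?thesis unfolding qle_def using F_props(3) fg by blast
qed

text \<open>A product of two filter elements witnesses two inequalities at once, as needed for
  bounds of meets and joins.\<close>

lemma F_common:
  assumes "f \<in> F" "g \<in> F" "x \<in> carrier A"
  shows "(f \<otimes>\<^bsub>A\<^esub> g) \<otimes>\<^bsub>A\<^esub> x \<^bold>\<le> f \<otimes>\<^bsub>A\<^esub> x" "(f \<otimes>\<^bsub>A\<^esub> g) \<otimes>\<^bsub>A\<^esub> x \<^bold>\<le> g \<otimes>\<^bsub>A\<^esub> x"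
  using assms F_carrier F_props(1) by (simp_all add: mult_mono_right neg_mult_le)

lemma qle_meet_iff:
  assumes "x \<in> carrier A" "y \<in> carrier A" "z \<in> carrier A"
  shows "z \<lesssim> x \<^bold>\<and> y \<longleftrightarrow> z \<lesssim> x \<and> z \<lesssim> y"
proof
  assume "z \<lesssim> x \<^bold>\<and> y"
  then show "z \<lesssim> x \<and> z \<lesssim> y"
    using assms by (meson le_imp_qle meet_le1 meet_le2 qle_trans rmeet_closed)
next
  assume "z \<lesssim> x \<and> z \<lesssim> y"
  then obtain f g where fg: "f \<in> F" "f \<otimes>\<^bsub>A\<^esub> z \<^bold>\<le> x" "g \<in> F" "g \<otimes>\<^bsub>A\<^esub> z \<^bold>\<le> y"
    by (auto simp: qle_def)
  have "(f \<otimes>\<^bsub>A\<^esub> g) \<otimes>\<^bsub>A\<^esub> z \<^bold>\<le> x \<^bold>\<and> y"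
    using F_common[of f g z] fg F_carrier assms
    by (simp add: le_meet_iff) (meson le_trans m_closed)
  then show "z \<lesssim> x \<^bold>\<and> y" unfolding qle_def using F_props(3) fg by blast
qed

lemma qle_join_iff:
  assumes "x \<in> carrier A" "y \<in> carrier A" "z \<in> carrier A"
  shows "x \<^bold>\<or> y \<lesssim> z \<longleftrightarrow> x \<lesssim> z \<and> y \<lesssim> z"
proof
  assume "x \<^bold>\<or> y \<lesssim> z"
  then show "x \<lesssim> z \<and> y \<lesssim> z"
    using assms by (meson le_imp_qle join_ge1 join_ge2 qle_trans rjoin_closed)
next
  assume "x \<lesssim> z \<and> y \<lesssim> z"
  then obtain f g where fg: "f \<in> F" "f \<otimes>\<^bsub>A\<^esub> x \<^bold>\<le> z" "g \<in> F" "g \<otimes>\<^bsub>A\<^esub> y \<^bold>\<le> z"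
    by (auto simp: qle_def)
  have "(f \<otimes>\<^bsub>A\<^esub> g) \<otimes>\<^bsub>A\<^esub> (x \<^bold>\<or> y) \<^bold>\<le> z"
    using F_common(1)[of f g x] F_common(2)[of f g y] fg F_carrier assms
    by (simp add: mult_join_distrib_left join_le_iff) (meson le_trans m_closed)
  then show "x \<^bold>\<or> y \<lesssim> z" unfolding qle_def using F_props(3) fg by blast
qed

text \<open>In the right-hand form of the preorder the filter element stays clear of
  \<open>a\<close>, so residuation in \<open>A\<close> applies with the same witness.\<close>

lemma qle_ldiv_iff:
  assumes "a \<in> carrier A" "b \<in> carrier A" "c \<in> carrier A"
  shows "b \<lesssim> ldiv A a c \<longleftrightarrow> a \<otimes>\<^bsub>A\<^esub> b \<lesssim> c"
  using assms F_carrier by (auto simp: qle_right ldiv_residual m_assoc)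

lemma qle_rdiv_iff:
  assumes "a \<in> carrier A" "b \<in> carrier A" "c \<in> carrier A"
  shows "a \<lesssim> rdiv A c b \<longleftrightarrow> a \<otimes>\<^bsub>A\<^esub> b \<lesssim> c"
  using assms F_carrier by (auto simp: qle_def rdiv_residual m_assoc)

text \<open>Compatibility follows from the two adjunctions and transitivity, without combining
  filter elements by hand.\<close>

lemma qle_mult:
  assumes "x \<lesssim> x'" "y \<lesssim> y'"
    "x \<in> carrier A" "x' \<in> carrier A" "y \<in> carrier A" "y' \<in> carrier A"
  shows "x \<otimes>\<^bsub>A\<^esub> y \<lesssim> x' \<otimes>\<^bsub>A\<^esub> y'"
proof -
  have "x' \<lesssim> rdiv A (x' \<otimes>\<^bsub>A\<^esub> y) y" "y' \<lesssim> ldiv A x' (x' \<otimes>\<^bsub>A\<^esub> y')"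
    using assms by (simp_all add: qle_rdiv_iff qle_ldiv_iff)
  then have "x \<lesssim> rdiv A (x' \<otimes>\<^bsub>A\<^esub> y) y" "y \<lesssim> ldiv A x' (x' \<otimes>\<^bsub>A\<^esub> y')"
    using assms qle_trans[of x x'] qle_trans[of y y'] by auto
  then have "x \<otimes>\<^bsub>A\<^esub> y \<lesssim> x' \<otimes>\<^bsub>A\<^esub> y" "x' \<otimes>\<^bsub>A\<^esub> y \<lesssim> x' \<otimes>\<^bsub>A\<^esub> y'"
    using assms by (simp_all add: qle_rdiv_iff qle_ldiv_iff)
  then show ?thesis using assms by (meson qle_trans m_closed)
qed

lemma qle_ldiv:
  assumes "x' \<lesssim> x" "y \<lesssim> y'"
    "x \<in> carrier A" "x' \<in> carrier A" "y \<in> carrier A" "y' \<in> carrier A"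
  shows "ldiv A x y \<lesssim> ldiv A x' y'"
proof -
  have "x' \<otimes>\<^bsub>A\<^esub> ldiv A x y \<lesssim> x \<otimes>\<^bsub>A\<^esub> ldiv A x y" using assms by (simp add: qle_mult)
  moreover have "x \<otimes>\<^bsub>A\<^esub> ldiv A x y \<lesssim> y" using assms by (simp flip: qle_ldiv_iff)
  ultimately show ?thesis
    using assms by (simp add: qle_ldiv_iff) (meson qle_trans m_closed ldiv_closed)
qed

lemma qle_rdiv:
  assumes "x \<lesssim> x'" "y' \<lesssim> y"
    "x \<in> carrier A" "x' \<in> carrier A" "y \<in> carrier A" "y' \<in> carrier A"
  shows "rdiv A x y \<lesssim> rdiv A x' y'"
proof -
  have "rdiv A x y \<otimes>\<^bsub>A\<^esub> y' \<lesssim> rdiv A x y \<otimes>\<^bsub>A\<^esub> y" using assms by (simp add: qle_mult)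
  moreover have "rdiv A x y \<otimes>\<^bsub>A\<^esub> y \<lesssim> x" using assms by (simp flip: qle_rdiv_iff)
  ultimately show ?thesis
    using assms by (simp add: qle_rdiv_iff) (meson qle_trans m_closed rdiv_closed)
qed

lemma qle_meet:
  assumes "x \<lesssim> x'" "y \<lesssim> y'"
    "x \<in> carrier A" "x' \<in> carrier A" "y \<in> carrier A" "y' \<in> carrier A"
  shows "x \<^bold>\<and> y \<lesssim> x' \<^bold>\<and> y'"
  using assms by (simp add: qle_meet_iff) (meson qle_trans le_imp_qle meet_le1 meet_le2 rmeet_closed)

lemma qle_join:
  assumes "x \<lesssim> x'" "y \<lesssim> y'"
    "x \<in> carrier A" "x' \<in> carrier A" "y \<in> carrier A" "y' \<in> carrier A"
  shows "x \<^bold>\<or> y \<lesssim> x' \<^bold>\<or> y'"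
  using assms by (simp add: qle_join_iff) (meson qle_trans le_imp_qle join_ge1 join_ge2 rjoin_closed)

text \<open>The quotient lives on chosen representatives, hence on the same type.\<close>

definition rep :: "'a \<Rightarrow> 'a" where
  "rep x = (SOME y. y \<in> carrier A \<and> x \<lesssim> y \<and> y \<lesssim> x)"

lemma rep:
  assumes "x \<in> carrier A"
  shows "rep x \<in> carrier A" "x \<lesssim> rep x" "rep x \<lesssim> x"
  using someI[of "\<lambda>y. y \<in> carrier A \<and> x \<lesssim> y \<and> y \<lesssim> x" x] assms
  unfolding rep_def by auto

lemma rep_eq_iff:
  assumes "x \<in> carrier A" "y \<in> carrier A"
  shows "rep x = rep y \<longleftrightarrow> x \<lesssim> y \<and> y \<lesssim> x"
proof
  assume "rep x = rep y"
  then show "x \<lesssim> y \<and> y \<lesssim> x" using assms by (metis qle_trans rep)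
next
  assume "x \<lesssim> y \<and> y \<lesssim> x"
  \<comment> \<open>Equivalent elements satisfy the same predicate, so \<open>SOME\<close> picks the
    same representative.\<close>
  then have "z \<in> carrier A \<and> x \<lesssim> z \<and> z \<lesssim> x \<longleftrightarrow> z \<in> carrier A \<and> y \<lesssim> z \<and> z \<lesssim> y" for z
    using assms by (meson qle_trans)
  then show "rep x = rep y" by (simp add: rep_def)
qed

definition quot :: "'a rlat" where
  "quot = \<lparr>carrier = rep ` carrier A, mult = \<lambda>x y. rep (x \<otimes>\<^bsub>A\<^esub> y), one = rep \<one>\<^bsub>A\<^esub>,
     rmeet = \<lambda>x y. rep (rmeet A x y), rjoin = \<lambda>x y. rep (rjoin A x y),
     ldiv = \<lambda>x y. rep (ldiv A x y), rdiv = \<lambda>x y. rep (rdiv A x y)\<rparr>"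

lemma quot_carrier: "carrier quot = rep ` carrier A" and quot_one: "\<one>\<^bsub>quot\<^esub> = rep \<one>\<^bsub>A\<^esub>"
  by (simp_all add: quot_def)

text \<open>The operations are monotone or antitone for the preorder in each argument, and
  \<open>rep x\<close> is equivalent to \<open>x\<close>, so passing to representatives does not
  change the class of a result.\<close>

lemma quot_ops:
  assumes "x \<in> carrier A" "y \<in> carrier A"
  shows "rep x \<otimes>\<^bsub>quot\<^esub> rep y = rep (x \<otimes>\<^bsub>A\<^esub> y)"
    "rmeet quot (rep x) (rep y) = rep (x \<^bold>\<and> y)"
    "rjoin quot (rep x) (rep y) = rep (x \<^bold>\<or> y)"
    "ldiv quot (rep x) (rep y) = rep (ldiv A x y)"
    "rdiv quot (rep x) (rep y) = rep (rdiv A x y)"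
  using assms
  by (simp_all add: quot_def rep_eq_iff rep qle_mult qle_meet qle_join qle_ldiv qle_rdiv)

lemma rep_hom: "rl_hom A quot rep"
  by (simp add: rl_hom_def quot_carrier quot_one quot_ops)

text \<open>Of the two inequalities behind equality of classes, only the one from \<open>x\<close>
  to the meet carries information, and it amounts to \<open>x \<lesssim> y\<close>.\<close>

lemma quot_le:
  assumes "x \<in> carrier A" "y \<in> carrier A"
  shows "rle quot (rep x) (rep y) \<longleftrightarrow> x \<lesssim> y"
proof -
  have "x \<^bold>\<and> y \<lesssim> x" using assms by (simp add: le_imp_qle)
  then show ?thesis using assms by (simp add: rle_def[of quot] quot_ops rep_eq_iff qle_meet_iff)
qed

lemma quot_residuated_lattice: "residuated_lattice quot"
proof (unfold_locales, goal_cases)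
  case (12 a b)
  then show ?case by (auto simp: quot_carrier quot_ops) (metis rmeet_comm)
next
  case (13 a b)
  then show ?case by (auto simp: quot_carrier quot_ops) (metis rjoin_comm)
qed (auto simp: quot_carrier quot_one quot_ops quot_le m_assoc rmeet_assoc rjoin_assoc
    rmeet_absorb rjoin_absorb qle_ldiv_iff qle_rdiv_iff)

lemma rep_F:
  assumes "f \<in> F"
  shows "rep f = \<one>\<^bsub>quot\<^esub>"
proof -
  have "\<one>\<^bsub>A\<^esub> \<lesssim> f"
    unfolding qle_def using assms F_carrier by (intro bexI[of _ f]) simp_all
  then show ?thesis
    using assms F_carrier F_props(1) by (simp add: quot_one rep_eq_iff le_imp_qle neg_coneD)
qed

end

text \<open>This element is the unit exactly when \<open>x = y\<close>. It encodes equality by one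
  element of the negative cone, where the filters live.\<close>

definition biresidual :: "'a rlat \<Rightarrow> 'a \<Rightarrow> 'a \<Rightarrow> 'a" where
  "biresidual A x y = rmeet A \<one>\<^bsub>A\<^esub> (rmeet A (ldiv A x y) (ldiv A y x))"

context residuated_lattice
begin

lemma biresidual_neg: "\<lbrakk>x \<in> carrier A; y \<in> carrier A\<rbrakk> \<Longrightarrow> biresidual A x y \<in> neg_cone"
  by (auto simp: biresidual_def)

lemma le_iff_ldiv:
  assumes "x \<in> carrier A" "y \<in> carrier A"
  shows "\<one>\<^bsub>A\<^esub> \<^bold>\<and> ldiv A x y = \<one>\<^bsub>A\<^esub> \<longleftrightarrow> x \<^bold>\<le> y"
  using assms by (simp add: ldiv_residual flip: rle_def)

lemma eq_iff_biresidual: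
  assumes "x \<in> carrier A" "y \<in> carrier A"
  shows "biresidual A x y = \<one>\<^bsub>A\<^esub> \<longleftrightarrow> x = y"
proof -
  have "biresidual A x y = \<one>\<^bsub>A\<^esub> \<longleftrightarrow> x \<^bold>\<le> y \<and> y \<^bold>\<le> x"
    using assms by (simp add: biresidual_def le_meet_iff ldiv_residual flip: rle_def)
  then show ?thesis using assms le_antisym by auto
qed

text \<open>Take the quotient by a filter from \<open>prime_filter_exists\<close> that omits
  \<open>biresidual A a b\<close>. If it identified \<open>a\<close> and \<open>b\<close>, some
  filter elements would lie below the two residuals, and their product would force the biresidual
  into the filter.\<close>

lemma separating_quotient:
  assumes "a \<in> carrier A" "b \<in> carrier A" "a \<noteq> b"
  obtains C :: "'a rlat" and h where "residuated_lattice C" "rl_hom A C h" "carrier C = h ` carrier A"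
    "h a \<noteq> h b"
    "\<forall>u\<in>neg_cone. \<forall>v\<in>neg_cone. orthogonal u v \<longrightarrow> h u = \<one>\<^bsub>C\<^esub> \<or> h v = \<one>\<^bsub>C\<^esub>"
proof -
  obtain F where nf: "normal_filter F" and notin: "biresidual A a b \<notin> F"
    and pr: "\<And>u v. \<lbrakk>u \<in> neg_cone; v \<in> neg_cone; orthogonal u v\<rbrakk> \<Longrightarrow> u \<in> F \<or> v \<in> F"
    using prime_filter_exists biresidual_neg assms eq_iff_biresidual by metis
  interpret rl_quotient A F by unfold_locales (fact nf)
  have "rep a \<noteq> rep b"
  proof
    assume "rep a = rep b"
    then obtain f g where fg: "f \<in> F" "a \<otimes>\<^bsub>A\<^esub> f \<^bold>\<le> b" "g \<in> F" "b \<otimes>\<^bsub>A\<^esub> g \<^bold>\<le> a"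
      using assms by (auto simp: rep_eq_iff qle_right)
    then have le: "f \<^bold>\<le> ldiv A a b" "g \<^bold>\<le> ldiv A b a"
      using assms F_carrier by (simp_all add: ldiv_residual)
    have "f \<otimes>\<^bsub>A\<^esub> g \<^bold>\<le> f" "f \<otimes>\<^bsub>A\<^esub> g \<^bold>\<le> g" "f \<otimes>\<^bsub>A\<^esub> g \<^bold>\<le> \<one>\<^bsub>A\<^esub>"
      using fg F_carrier F_props neg_mult_le neg_coneD by auto
    then have "f \<otimes>\<^bsub>A\<^esub> g \<^bold>\<le> biresidual A a b"
      using le fg F_carrier assms
      by (simp add: biresidual_def le_meet_iff) (meson le_trans m_closed ldiv_closed)
    then show False using F_props(3,4) fg notin biresidual_neg assms by blast
  qed
  moreover have "\<forall>u\<in>neg_cone. \<forall>v\<in>neg_cone. orthogonal u v \<longrightarrow> rep u = \<one>\<^bsub>quot\<^esub> \<or> rep v = \<one>\<^bsub>quot\<^esub>"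
    using pr rep_F by blast
  ultimately show thesis
    using that[OF quot_residuated_lattice rep_hom quot_carrier] by blast
qed

end

text \<open>The parameters of conjugates become variables, so that a condition on all parameters
  becomes validity of equations.\<close>

primrec conjugate_term :: "bool \<times> nat \<Rightarrow> rterm \<Rightarrow> rterm" where
  "conjugate_term (l, n) t =
     Meet (if l then LDiv (Var n) (Mult t (Var n)) else RDiv (Mult (Var n) t) (Var n)) Unit"

lemma eval_iterated_conjugate:
  "eval_term A \<rho> (foldr conjugate_term ps t) =
     iterated_conjugate A (map (map_prod id \<rho>) ps) (eval_term A \<rho> t)"
  by (induction ps) (auto simp: iterated_conjugate_def conjugate_def)

text \<open>Once the tags and variables of the conjugations are fixed, orthogonality is a single
  equation. It holds throughout \<open>K\<close>, hence in \<open>A\<close>, where an assignment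
  supplies the actual parameters.\<close>

lemma orthogonal_in_models:
  fixes K :: "'u rlat set" and A :: "'a rlat"
  assumes K: "\<And>C \<rho>. \<lbrakk>C \<in> K; range \<rho> \<subseteq> carrier C\<rbrakk> \<Longrightarrow>
      residuated_lattice.orthogonal C (eval_term C \<rho> s) (eval_term C \<rho> t)"
    and RL: "\<And>C. C \<in> K \<Longrightarrow> residuated_lattice C"
    and A: "A \<in> models (equations_of K)"
    and c: "a \<in> carrier A" "b \<in> carrier A" "snd ` set ps \<subseteq> carrier A" "snd ` set qs \<subseteq> carrier A"
  obtains \<rho> where "\<rho> 0 = a" "\<rho> (Suc 0) = b"
    "rjoin A (iterated_conjugate A ps (eval_term A \<rho> s))
       (iterated_conjugate A qs (eval_term A \<rho> t)) = \<one>\<^bsub>A\<^esub>"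
proof -
  interpret residuated_lattice A using A by (simp add: models_def)
  \<comment> \<open>Positions 0 and 1 are reserved for \<open>a\<close> and \<open>b\<close>, and
    the parameters of both lists follow. All later variables default to the unit, which keeps the
    assignment inside the carrier.\<close>
  define xs where "xs = a # b # map snd ps @ map snd qs"
  define \<rho> where "\<rho> n = (if n < length xs then xs ! n else \<one>\<^bsub>A\<^esub>)" for n
  have xs: "set xs \<subseteq> carrier A" using c by (auto simp: xs_def)
  then have \<rho>: "range \<rho> \<subseteq> carrier A" by (auto simp: \<rho>_def subset_iff)
  have "x \<in> range \<rho>" if "x \<in> set xs" for x
    using that by (metis \<rho>_def in_set_conv_nth rangeI)
  then have r: "snd ` set ps \<subseteq> range \<rho>" "snd ` set qs \<subseteq> range \<rho>" by (auto simp: xs_def)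
  \<comment> \<open>Each parameter is the value of some variable, so a list of parameters lifts to a
    list of variables with the same tags.\<close>
  have ex: "\<exists>ns. rs = map (map_prod id \<rho>) ns" if "snd ` set rs \<subseteq> range \<rho>"
    for rs :: "(bool \<times> 'a) list"
    unfolding ex_map_conv
  proof
    fix p assume "p \<in> set rs"
    then have "snd p \<in> range \<rho>" using that by blast
    then obtain n where "snd p = \<rho> n" by blast
    then have "p = map_prod id \<rho> (fst p, n)" by (simp add: prod_eq_iff)
    then show "\<exists>q. p = map_prod id \<rho> q" ..
  qed
  obtain ms where "ps = map (map_prod id \<rho>) ms" using ex[OF r(1)] ..
  moreover obtain ns where "qs = map (map_prod id \<rho>) ns" using ex[OF r(2)] ..
  ultimately have mn: "ps = map (map_prod id \<rho>) ms" "qs = map (map_prod id \<rho>) ns" .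
  let ?e = "(Join (foldr conjugate_term ms s) (foldr conjugate_term ns t), Unit)"
  have "satisfies C ?e" if "C \<in> K" for C
    unfolding satisfies_def
  proof (intro allI impI)
    fix \<sigma> :: "nat \<Rightarrow> 'u" assume \<sigma>: "range \<sigma> \<subseteq> carrier C"
    have "snd ` set (map (map_prod id \<sigma>) ks) \<subseteq> carrier C" for ks :: "(bool \<times> nat) list"
      using \<sigma> by auto
    then show "eval_term C \<sigma> (fst ?e) = eval_term C \<sigma> (snd ?e)"
      using K[OF that \<sigma>] by (simp add: residuated_lattice.orthogonal_def[OF RL[OF that]]
          eval_iterated_conjugate)
  qed
  then have "satisfies A ?e" using A by (auto simp: models_def equations_of_def)
  with \<rho> have "rjoin A (iterated_conjugate A ps (eval_term A \<rho> s))
       (iterated_conjugate A qs (eval_term A \<rho> t)) = \<one>\<^bsub>A\<^esub>"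
    by (simp add: satisfies_def eval_iterated_conjugate mn)
  moreover have "\<rho> 0 = a" "\<rho> (Suc 0) = b" by (simp_all add: \<rho>_def xs_def)
  ultimately show thesis using that by blast
qed

section \<open>Products and partial embeddings\<close>

text \<open>Restriction to \<open>I\<close> makes the elements extensional: equality is equality on
  \<open>I\<close>, and finitely many finite factors have a product with finite carrier.\<close>

definition product_rl :: "'i set \<Rightarrow> ('i \<Rightarrow> 'a rlat) \<Rightarrow> ('i \<Rightarrow> 'a) rlat" where
  "product_rl I D = (let pw = (\<lambda>op x y. \<lambda>i\<in>I. op (D i) (x i) (y i)) in
     \<lparr>carrier = \<Pi>\<^sub>E i\<in>I. carrier (D i), mult = pw mult, one = (\<lambda>i\<in>I. \<one>\<^bsub>D i\<^esub>),
      rmeet = pw rmeet, rjoin = pw rjoin, ldiv = pw ldiv, rdiv = pw rdiv\<rparr>)"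

lemma product_rl_simps:
  "carrier (product_rl I D) = (\<Pi>\<^sub>E i\<in>I. carrier (D i))"
  "\<one>\<^bsub>product_rl I D\<^esub> = (\<lambda>i\<in>I. \<one>\<^bsub>D i\<^esub>)"
  "x \<otimes>\<^bsub>product_rl I D\<^esub> y = (\<lambda>i\<in>I. x i \<otimes>\<^bsub>D i\<^esub> y i)"
  "rmeet (product_rl I D) x y = (\<lambda>i\<in>I. rmeet (D i) (x i) (y i))"
  "rjoin (product_rl I D) x y = (\<lambda>i\<in>I. rjoin (D i) (x i) (y i))"
  "ldiv (product_rl I D) x y = (\<lambda>i\<in>I. ldiv (D i) (x i) (y i))"
  "rdiv (product_rl I D) x y = (\<lambda>i\<in>I. rdiv (D i) (x i) (y i))"
  by (simp_all add: product_rl_def Let_def)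

lemma product_rl_rle:
  assumes "x \<in> carrier (product_rl I D)" "y \<in> carrier (product_rl I D)"
  shows "rle (product_rl I D) x y \<longleftrightarrow> (\<forall>i\<in>I. rle (D i) (x i) (y i))"
  using assms by (auto simp: rle_def product_rl_simps fun_eq_iff PiE_def extensional_def)

lemma product_rl_residuated_lattice:
  assumes "\<And>i. i \<in> I \<Longrightarrow> residuated_lattice (D i)"
  shows "residuated_lattice (product_rl I D)"
proof -
  note RL = assms[THEN residuated_lattice.axioms(1)] assms
  have PiE_eq: "x = restrict y I" if "x \<in> (\<Pi>\<^sub>E i\<in>I. carrier (D i))" "\<And>i. i \<in> I \<Longrightarrow> x i = y i" for x y
    using that by (auto simp: PiE_iff extensional_def fun_eq_iff)
  have closed: "f \<otimes>\<^bsub>product_rl I D\<^esub> g \<in> carrier (product_rl I D)"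
    "ldiv (product_rl I D) f g \<in> carrier (product_rl I D)"
    "rdiv (product_rl I D) f g \<in> carrier (product_rl I D)"
    if "f \<in> carrier (product_rl I D)" "g \<in> carrier (product_rl I D)" for f g
    using that
    by (auto simp: product_rl_simps PiE_iff RL monoid.m_closed
        residuated_lattice.ldiv_closed residuated_lattice.rdiv_closed)
  show ?thesis
  proof (unfold_locales, goal_cases)
    case (16 a b c)
    then show ?case
      by (simp add: product_rl_rle closed)
        (auto simp: product_rl_simps PiE_iff RL residuated_lattice.ldiv_residual)
  next
    case (17 a b c)
    then show ?case
      by (simp add: product_rl_rle closed)
        (auto simp: product_rl_simps PiE_iff RL residuated_lattice.rdiv_residual)
  qed (auto simp: product_rl_simps PiE_iff RL monoid.m_closed monoid.m_assoc monoid.l_one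
      monoid.r_one monoid.one_closed
      residuated_lattice.rmeet_closed residuated_lattice.rjoin_closed
      residuated_lattice.ldiv_closed residuated_lattice.rdiv_closed
      residuated_lattice.rmeet_assoc residuated_lattice.rjoin_assoc
      residuated_lattice.rmeet_absorb residuated_lattice.rjoin_absorb
      extensional_def
      intro!: restrict_ext PiE_eq[symmetric]
      intro: residuated_lattice.rmeet_comm residuated_lattice.rjoin_comm)
qed

lemma product_rl_eval:
  "i \<in> I \<Longrightarrow> range \<rho> \<subseteq> carrier (product_rl I D) \<Longrightarrow>
     eval_term (product_rl I D) \<rho> t i = eval_term (D i) (\<lambda>n. \<rho> n i) t"
  by (induction t) (simp_all add: product_rl_simps)

lemma product_rl_satisfies:
  assumes "\<And>i. i \<in> I \<Longrightarrow> residuated_lattice (D i)" "\<And>i. i \<in> I \<Longrightarrow> satisfies (D i) e"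
  shows "satisfies (product_rl I D) e"
  unfolding satisfies_def
proof (intro allI impI)
  fix \<rho> :: "nat \<Rightarrow> 'a \<Rightarrow> 'b" assume \<rho>: "range \<rho> \<subseteq> carrier (product_rl I D)"
  have c: "eval_term (product_rl I D) \<rho> t \<in> (\<Pi>\<^sub>E i\<in>I. carrier (D i))" for t
    using eval_term_closed[OF product_rl_residuated_lattice \<rho>] assms(1)
    by (simp add: product_rl_simps)
  show "eval_term (product_rl I D) \<rho> (fst e) = eval_term (product_rl I D) \<rho> (snd e)"
  proof (rule PiE_ext[OF c c])
    fix i assume i: "i \<in> I"
    then have "range (\<lambda>n. \<rho> n i) \<subseteq> carrier (D i)"
      using \<rho> by (auto simp: product_rl_simps PiE_iff image_subset_iff)
    then show "eval_term (product_rl I D) \<rho> (fst e) i = eval_term (product_rl I D) \<rho> (snd e) i"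
      using i \<rho> assms(2) by (simp add: product_rl_eval satisfies_def)
  qed
qed

text \<open>A partial embedding without injectivity: one coordinate is only asked to separate one
  pair, and injectivity arises in the product.\<close>

definition partial_hom :: "'a rlat \<Rightarrow> 'a set \<Rightarrow> 'b rlat \<Rightarrow> ('a \<Rightarrow> 'b) \<Rightarrow> bool" where
  "partial_hom A B D h \<longleftrightarrow>
     h ` B \<subseteq> carrier D \<and> (\<one>\<^bsub>A\<^esub> \<in> B \<longrightarrow> h \<one>\<^bsub>A\<^esub> = \<one>\<^bsub>D\<^esub>) \<and>
     preserves_op B h (mult A) (mult D) \<and> preserves_op B h (rmeet A) (rmeet D) \<and>
     preserves_op B h (rjoin A) (rjoin D) \<and> preserves_op B h (ldiv A) (ldiv D) \<and>
     preserves_op B h (rdiv A) (rdiv D)"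

lemma partial_embedding_iff: "partial_embedding A B D h \<longleftrightarrow> partial_hom A B D h \<and> inj_on h B"
  by (auto simp: partial_embedding_def partial_hom_def)

text \<open>A value of an operation that lies in \<open>B\<close> is sent by \<open>g\<close> to the
  corresponding value in \<open>C\<close>, which lies in the image of \<open>B\<close>; so
  \<open>h\<close> has to preserve it.\<close>

lemma partial_hom_comp:
  assumes "rl_hom A C g" "B \<subseteq> carrier A" "partial_hom C (g ` B) D h"
  shows "partial_hom A B D (h \<circ> g)"
proof -
  have op: "preserves_op B (h \<circ> g) f f''"
    if "preserves_op (g ` B) h f' f''" "\<And>x y. \<lbrakk>x \<in> B; y \<in> B\<rbrakk> \<Longrightarrow> g (f x y) = f' (g x) (g y)"
    for f f' f''
    unfolding preserves_op_def
  proof (intro ballI impI)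
    fix x y assume xy: "x \<in> B" "y \<in> B" "f x y \<in> B"
    then have "f' (g x) (g y) \<in> g ` B" using that(2) by (metis imageI)
    then have "h (f' (g x) (g y)) = f'' (h (g x)) (h (g y))"
      using that(1) xy by (simp add: preserves_op_def)
    then show "(h \<circ> g) (f x y) = f'' ((h \<circ> g) x) ((h \<circ> g) y)" using that(2) xy by simp
  qed
  have B: "x \<in> carrier A" if "x \<in> B" for x using that assms(2) by blast
  show ?thesis
    unfolding partial_hom_def
  proof (intro conjI impI)
    show "(h \<circ> g) ` B \<subseteq> carrier D" using assms(3) by (auto simp: partial_hom_def)
    show "(h \<circ> g) \<one>\<^bsub>A\<^esub> = \<one>\<^bsub>D\<^esub>" if "\<one>\<^bsub>A\<^esub> \<in> B"
      using imageI[OF that, of g] assms(1,3) by (simp add: rl_hom_def partial_hom_def)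
    show "preserves_op B (h \<circ> g) (mult A) (mult D)"
      by (rule op[of "mult C"]) (use assms(1,3) B in \<open>simp_all add: rl_hom_def partial_hom_def\<close>)
    show "preserves_op B (h \<circ> g) (rmeet A) (rmeet D)"
      by (rule op[of "rmeet C"]) (use assms(1,3) B in \<open>simp_all add: rl_hom_def partial_hom_def\<close>)
    show "preserves_op B (h \<circ> g) (rjoin A) (rjoin D)"
      by (rule op[of "rjoin C"]) (use assms(1,3) B in \<open>simp_all add: rl_hom_def partial_hom_def\<close>)
    show "preserves_op B (h \<circ> g) (ldiv A) (ldiv D)"
      by (rule op[of "ldiv C"]) (use assms(1,3) B in \<open>simp_all add: rl_hom_def partial_hom_def\<close>)
    show "preserves_op B (h \<circ> g) (rdiv A) (rdiv D)"
      by (rule op[of "rdiv C"]) (use assms(1,3) B in \<open>simp_all add: rl_hom_def partial_hom_def\<close>)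
  qed
qed

lemma partial_hom_product:
  assumes "\<And>i. i \<in> I \<Longrightarrow> partial_hom A B (D i) (h i)"
  shows "partial_hom A B (product_rl I D) (\<lambda>x. \<lambda>i\<in>I. h i x)"
proof -
  have "h i x \<in> carrier (D i)" if "i \<in> I" "x \<in> B" for i x
    using assms[OF that(1)] that(2) by (auto simp: partial_hom_def)
  then show ?thesis
    using assms unfolding partial_hom_def preserves_op_def
    by (auto simp: product_rl_simps intro!: restrict_ext)
qed

section \<open>Finite algebras copied to the natural numbers\<close>

lemma finite_nat_copy:
  assumes "residuated_lattice D" "finite (carrier D)"
  obtains f :: "'a \<Rightarrow> nat" where "transport D (carrier D) f"
proof -
  interpret residuated_lattice D by fact
  obtain f :: "'a \<Rightarrow> nat" where "inj_on f (carrier D)"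
    using finite_imp_inj_to_nat_seg[OF assms(2)] by blast
  then have "transport D (carrier D) f" by unfold_locales auto
  then show thesis by (rule that)
qed

context transport
begin

text \<open>As \<open>f\<close> maps the whole carrier onto the copy, every assignment into the copy
  is the image of an assignment into \<open>A\<close>.\<close>

lemma tr_satisfies:
  assumes "satisfies A e" "S = carrier A"
  shows "satisfies (transported f S A) e"
  unfolding satisfies_def
proof (intro allI impI)
  fix \<rho> :: "nat \<Rightarrow> 'b" assume "range \<rho> \<subseteq> carrier (transported f S A)"
  then have r: "\<rho> n \<in> f ` S" for n by (auto simp: tr_simps)
  define \<sigma> where "\<sigma> = inv_into S f \<circ> \<rho>"
  have \<sigma>: "range \<sigma> \<subseteq> S" using r by (auto simp: \<sigma>_def intro: inv_into_into)
  have "\<rho> = f \<circ> \<sigma>" using r by (auto simp: \<sigma>_def f_inv_into_f)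
  then show "eval_term (transported f S A) \<rho> (fst e) = eval_term (transported f S A) \<rho> (snd e)"
    using tr_eval_term[OF \<sigma>] assms \<sigma> by (simp add: satisfies_def)
qed

lemma tr_partial_embedding:
  assumes "partial_embedding E B A h" "S = carrier A"
  shows "partial_embedding E B (transported f S A) (f \<circ> h)"
proof -
  have hS: "x \<in> B \<Longrightarrow> h x \<in> S" for x using assms by (auto simp: partial_embedding_def)
  have "inj_on (f \<circ> h) B"
    using assms inj by (auto simp: partial_embedding_def intro!: comp_inj_on intro: inj_on_subset)
  then show ?thesis
    using assms(1) hS unfolding partial_embedding_def preserves_op_def
    by (auto simp: tr_simps)
qed

end

text \<open>The generators occur over three types: \<open>K\<^sub>1\<close> defines the variety,
  \<open>K\<^sub>2\<close> receives the homomorphic images of \<open>A\<close>, and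
  \<open>K\<^sub>3\<close> supplies finite algebras. With one coordinate for each pair of distinct
  elements of \<open>B\<close>, the set embeds into a finite product, which inherits the equations
  of \<open>K\<^sub>1\<close> from its factors.\<close>

lemma fep_from_generators:
  fixes K\<^sub>1 :: "'u rlat set" and K\<^sub>2 :: "'a rlat set" and K\<^sub>3 :: "nat rlat set"
  assumes sep: "\<And>A a b. \<lbrakk>(A :: 'a rlat) \<in> models (equations_of K\<^sub>1); a \<in> carrier A; b \<in> carrier A; a \<noteq> b\<rbrakk>
      \<Longrightarrow> \<exists>C\<in>K\<^sub>2. \<exists>g. rl_hom A C g \<and> g a \<noteq> g b"
    and fin: "\<And>C B. \<lbrakk>C \<in> K\<^sub>2; B \<subseteq> carrier C; finite B\<rbrakk>
      \<Longrightarrow> \<exists>D\<in>K\<^sub>3. finite (carrier D) \<and> (\<exists>h. partial_embedding C B D h)"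
    and RL: "\<And>D. D \<in> K\<^sub>3 \<Longrightarrow> residuated_lattice D"
    and eqs: "equations_of K\<^sub>1 \<subseteq> equations_of K\<^sub>3"
  shows "finite_embeddability_property TYPE('a) (equations_of K\<^sub>1)"
  unfolding finite_embeddability_property_def
proof (intro ballI allI impI)
  fix A :: "'a rlat" and B assume A: "A \<in> models (equations_of K\<^sub>1)"
    and "B \<subseteq> carrier A \<and> finite B"
  then have B: "B \<subseteq> carrier A" "finite B" by auto
  define I where "I = {i \<in> B \<times> B. fst i \<noteq> snd i}"
  have "finite I" using B by (simp add: I_def)
  have "\<exists>D h. D \<in> K\<^sub>3 \<and> finite (carrier D) \<and> partial_hom A B D h \<and> h (fst i) \<noteq> h (snd i)"
    if "i \<in> I" for i
  proof -
    from that have i: "fst i \<in> B" "snd i \<in> B" "fst i \<noteq> snd i" by (auto simp: I_def)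
    have "\<exists>C\<in>K\<^sub>2. \<exists>g. rl_hom A C g \<and> g (fst i) \<noteq> g (snd i)"
      using B i by (intro sep[OF A]) auto
    then obtain C g where C: "C \<in> K\<^sub>2" "rl_hom A C g" "g (fst i) \<noteq> g (snd i)" by blast
    \<comment> \<open>The homomorphism keeps only the chosen pair apart. The image of
      \<open>B\<close> is finite and embeds into a finite generator, which preserves this
      separation.\<close>
    have "g ` B \<subseteq> carrier C" using C B by (auto simp: rl_hom_def)
    then obtain D h where D: "D \<in> K\<^sub>3" "finite (carrier D)" "partial_embedding C (g ` B) D h"
      using fin[OF C(1)] B by blast
    then have "partial_hom A B D (h \<circ> g)" "inj_on h (g ` B)"
      using partial_hom_comp C B by (auto simp: partial_embedding_iff)
    moreover have "(h \<circ> g) (fst i) \<noteq> (h \<circ> g) (snd i)"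
      using C i \<open>inj_on h (g ` B)\<close> by (auto dest: inj_onD)
    ultimately show ?thesis using D by blast
  qed
  then obtain D h where Dh: "\<And>i. i \<in> I \<Longrightarrow> D i \<in> K\<^sub>3" "\<And>i. i \<in> I \<Longrightarrow> finite (carrier (D i))"
    "\<And>i. i \<in> I \<Longrightarrow> partial_hom A B (D i) (h i)"
    "\<And>i. i \<in> I \<Longrightarrow> h i (fst i) \<noteq> h i (snd i)"
    by metis
  let ?P = "product_rl I D" and ?h = "\<lambda>x. \<lambda>i\<in>I. h i x"
  have "inj_on ?h B"
  proof (rule inj_onI, rule ccontr)
    fix x y assume *: "x \<in> B" "y \<in> B" "?h x = ?h y" "x \<noteq> y"
    then have "(x, y) \<in> I" by (simp add: I_def)
    then show False using Dh(4)[of "(x, y)"] fun_cong[OF *(3), of "(x, y)"] by simp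
  qed
  then have emb: "partial_embedding A B ?P ?h"
    using partial_hom_product[of I A B D h] Dh(3) by (simp add: partial_embedding_iff)
  have P: "residuated_lattice ?P" using Dh RL by (simp add: product_rl_residuated_lattice)
  have fP: "finite (carrier ?P)"
    using \<open>finite I\<close> Dh by (simp add: product_rl_simps finite_PiE)
  have sat: "satisfies ?P e" if "e \<in> equations_of K\<^sub>1" for e
    using that eqs Dh RL by (intro product_rl_satisfies) (auto simp: equations_of_def)
  obtain f :: "_ \<Rightarrow> nat" where "transport ?P (carrier ?P) f" using finite_nat_copy[OF P fP] .
  then interpret transport ?P "carrier ?P" f .
  let ?D = "transported f (carrier ?P) ?P"
  have "?D \<in> models (equations_of K\<^sub>1)"
    using tr_residuated_lattice tr_satisfies sat by (simp add: models_def)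
  moreover have "finite (carrier ?D)" using fP by (simp add: tr_simps)
  moreover have "partial_embedding A B ?D (f \<circ> ?h)" using tr_partial_embedding emb by simp
  ultimately show "\<exists>D\<in>(models (equations_of K\<^sub>1) :: nat rlat set).
      finite (carrier D) \<and> (\<exists>h. partial_embedding A B D h)"
    by blast
qed

section \<open>Finite subsets of conservative residuated lattices\<close>

text \<open>Multiplication preserves all finite joins, including the empty one, which is
  \<open>bot\<close>. By finiteness these are all joins, so meets and residuals exist.\<close>

locale finite_join_monoid =
  fixes S :: "'a set" and m j :: "'a \<Rightarrow> 'a \<Rightarrow> 'a" and e bot :: 'a
  assumes finite_S: "finite S"
    and bot_closed: "bot \<in> S" and e_closed: "e \<in> S"
    and mult_closed: "\<lbrakk>x \<in> S; y \<in> S\<rbrakk> \<Longrightarrow> m x y \<in> S"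
    and mult_assoc: "\<lbrakk>x \<in> S; y \<in> S; z \<in> S\<rbrakk> \<Longrightarrow> m (m x y) z = m x (m y z)"
    and mult_e: "x \<in> S \<Longrightarrow> m e x = x" "x \<in> S \<Longrightarrow> m x e = x"
    and j_closed: "\<lbrakk>x \<in> S; y \<in> S\<rbrakk> \<Longrightarrow> j x y \<in> S"
    and j_assoc: "\<lbrakk>x \<in> S; y \<in> S; z \<in> S\<rbrakk> \<Longrightarrow> j (j x y) z = j x (j y z)"
    and j_comm: "\<lbrakk>x \<in> S; y \<in> S\<rbrakk> \<Longrightarrow> j x y = j y x"
    and j_idem: "x \<in> S \<Longrightarrow> j x x = x"
    and j_bot: "x \<in> S \<Longrightarrow> j bot x = x"
    and mult_j: "\<lbrakk>x \<in> S; y \<in> S; z \<in> S\<rbrakk> \<Longrightarrow> m x (j y z) = j (m x y) (m x z)"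
      "\<lbrakk>x \<in> S; y \<in> S; z \<in> S\<rbrakk> \<Longrightarrow> m (j y z) x = j (m y x) (m z x)"
    and mult_bot: "x \<in> S \<Longrightarrow> m x bot = bot" "x \<in> S \<Longrightarrow> m bot x = bot"
begin

definition le (infix \<open>\<sqsubseteq>\<close> 50) where "x \<sqsubseteq> y \<longleftrightarrow> j x y = y"

definition greatest :: "('a \<Rightarrow> bool) \<Rightarrow> 'a" where
  "greatest P = (SOME z. z \<in> S \<and> P z \<and> (\<forall>w\<in>S. P w \<longrightarrow> w \<sqsubseteq> z))"

lemma le_refl [simp]: "x \<in> S \<Longrightarrow> x \<sqsubseteq> x"
  by (simp add: le_def j_idem)

lemma le_antisym: "\<lbrakk>x \<sqsubseteq> y; y \<sqsubseteq> x; x \<in> S; y \<in> S\<rbrakk> \<Longrightarrow> x = y"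
  by (metis le_def j_comm)

lemma le_trans: "\<lbrakk>x \<sqsubseteq> y; y \<sqsubseteq> z; x \<in> S; y \<in> S; z \<in> S\<rbrakk> \<Longrightarrow> x \<sqsubseteq> z"
  by (metis le_def j_assoc)

lemma le_j1: "\<lbrakk>x \<in> S; y \<in> S\<rbrakk> \<Longrightarrow> x \<sqsubseteq> j x y"
  by (simp add: le_def j_idem flip: j_assoc)

lemma le_j2: "\<lbrakk>x \<in> S; y \<in> S\<rbrakk> \<Longrightarrow> y \<sqsubseteq> j x y"
  by (metis j_comm le_j1)

lemma j_le: "\<lbrakk>x \<sqsubseteq> z; y \<sqsubseteq> z; x \<in> S; y \<in> S; z \<in> S\<rbrakk> \<Longrightarrow> j x y \<sqsubseteq> z"
  by (simp add: le_def j_assoc)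

lemma bot_le: "x \<in> S \<Longrightarrow> bot \<sqsubseteq> x"
  by (simp add: le_def j_bot)

lemma greatest_eqI:
  assumes "z \<in> S" "P z" "\<And>w. \<lbrakk>w \<in> S; P w\<rbrakk> \<Longrightarrow> w \<sqsubseteq> z"
  shows "greatest P = z"
  unfolding greatest_def by (rule some_equality) (use assms le_antisym in auto)

text \<open>\<open>P\<close> is closed under finite joins, the empty one included, so the join of
  its finitely many elements in \<open>S\<close> is its greatest one. The induction collects these
  elements over subsets \<open>T\<close>.\<close>

lemma greatest:
  assumes "P bot" "\<And>x y. \<lbrakk>x \<in> S; y \<in> S; P x; P y\<rbrakk> \<Longrightarrow> P (j x y)"
  shows "greatest P \<in> S" "P (greatest P)" "\<And>w. \<lbrakk>w \<in> S; P w\<rbrakk> \<Longrightarrow> w \<sqsubseteq> greatest P"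
proof -
  have "\<exists>z\<in>S. P z \<and> (\<forall>w\<in>T. P w \<longrightarrow> w \<sqsubseteq> z)" if "finite T" "T \<subseteq> S" for T
    using that
  proof induction
    case empty
    then show ?case using assms(1) bot_closed by blast
  next
    case (insert x T)
    then obtain z where z: "z \<in> S" "P z" "\<forall>w\<in>T. P w \<longrightarrow> w \<sqsubseteq> z" by auto
    have x: "x \<in> S" "T \<subseteq> S" using insert by auto
    show ?case
    proof (cases "P x")
      case True
      have "w \<sqsubseteq> j x z" if "w \<in> T" "P w" for w
        using that z x le_trans[of w z "j x z"] le_j2[of x z] j_closed[of x z] by auto
      then have "\<forall>w\<in>insert x T. P w \<longrightarrow> w \<sqsubseteq> j x z" using le_j1 x z by blast
      then show ?thesis using assms(2) True z x j_closed by blast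
    next
      case False
      then show ?thesis using z by blast
    qed
  qed
  from this[OF finite_S] have ex: "\<exists>z. z \<in> S \<and> P z \<and> (\<forall>w\<in>S. P w \<longrightarrow> w \<sqsubseteq> z)" by blast
  from someI_ex[OF ex]
  show "greatest P \<in> S" "P (greatest P)" "\<And>w. \<lbrakk>w \<in> S; P w\<rbrakk> \<Longrightarrow> w \<sqsubseteq> greatest P"
    unfolding greatest_def by auto
qed

text \<open>A downward closed \<open>P\<close> of this kind is a principal ideal of
  \<open>S\<close>.\<close>

lemma le_greatest_iff:
  assumes "P bot" "\<And>x y. \<lbrakk>x \<in> S; y \<in> S; P x; P y\<rbrakk> \<Longrightarrow> P (j x y)"
    and down: "\<And>x y. \<lbrakk>x \<in> S; y \<in> S; x \<sqsubseteq> y; P y\<rbrakk> \<Longrightarrow> P x"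
    and "w \<in> S"
  shows "w \<sqsubseteq> greatest P \<longleftrightarrow> P w"
  using greatest[of P, OF assms(1,2)] assms(4) down by blast

definition algebra :: "'a rlat" where
  "algebra = \<lparr>carrier = S, mult = m, one = e, rmeet = \<lambda>x y. greatest (\<lambda>z. z \<sqsubseteq> x \<and> z \<sqsubseteq> y),
     rjoin = j, ldiv = \<lambda>a c. greatest (\<lambda>z. m a z \<sqsubseteq> c), rdiv = \<lambda>c b. greatest (\<lambda>z. m z b \<sqsubseteq> c)\<rparr>"

lemma algebra_fields [simp]:
  "carrier algebra = S" "mult algebra = m" "one algebra = e" "rjoin algebra = j"
  "rmeet algebra x y = greatest (\<lambda>z. z \<sqsubseteq> x \<and> z \<sqsubseteq> y)"
  "ldiv algebra x y = greatest (\<lambda>z. m x z \<sqsubseteq> y)"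
  "rdiv algebra x y = greatest (\<lambda>z. m z y \<sqsubseteq> x)"
  by (simp_all add: algebra_def)

lemma meet:
  assumes "x \<in> S" "y \<in> S"
  defines "P \<equiv> \<lambda>z. z \<sqsubseteq> x \<and> z \<sqsubseteq> y"
  shows "greatest P \<in> S" "w \<in> S \<Longrightarrow> w \<sqsubseteq> greatest P \<longleftrightarrow> w \<sqsubseteq> x \<and> w \<sqsubseteq> y"
proof -
  have P: "P bot" "\<And>x y. \<lbrakk>x \<in> S; y \<in> S; P x; P y\<rbrakk> \<Longrightarrow> P (j x y)"
    "\<And>x y. \<lbrakk>x \<in> S; y \<in> S; x \<sqsubseteq> y; P y\<rbrakk> \<Longrightarrow> P x"
    using assms by (auto simp: P_def bot_le intro: j_le le_trans)
  show "greatest P \<in> S" using greatest[of P] P by blast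
  show "w \<in> S \<Longrightarrow> w \<sqsubseteq> greatest P \<longleftrightarrow> w \<sqsubseteq> x \<and> w \<sqsubseteq> y"
    using le_greatest_iff[of P w] P unfolding P_def by blast
qed

lemma mult_mono:
  assumes "x \<sqsubseteq> y" "x \<in> S" "y \<in> S" "z \<in> S"
  shows "m z x \<sqsubseteq> m z y" "m x z \<sqsubseteq> m y z"
  using assms by (simp_all add: le_def flip: mult_j)

lemma ldiv:
  assumes "a \<in> S" "c \<in> S"
  defines "P \<equiv> \<lambda>z. m a z \<sqsubseteq> c"
  shows "greatest P \<in> S" "w \<in> S \<Longrightarrow> w \<sqsubseteq> greatest P \<longleftrightarrow> m a w \<sqsubseteq> c"
proof -
  have P: "P bot" "\<And>x y. \<lbrakk>x \<in> S; y \<in> S; P x; P y\<rbrakk> \<Longrightarrow> P (j x y)"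
    "\<And>x y. \<lbrakk>x \<in> S; y \<in> S; x \<sqsubseteq> y; P y\<rbrakk> \<Longrightarrow> P x"
    using assms
    by (auto simp: P_def bot_le mult_bot mult_j mult_closed j_le intro: le_trans[OF mult_mono(1)])
  show "greatest P \<in> S" using greatest[of P] P by blast
  show "w \<in> S \<Longrightarrow> w \<sqsubseteq> greatest P \<longleftrightarrow> m a w \<sqsubseteq> c"
    using le_greatest_iff[of P w] P unfolding P_def by blast
qed

lemma rdiv:
  assumes "b \<in> S" "c \<in> S"
  defines "P \<equiv> \<lambda>z. m z b \<sqsubseteq> c"
  shows "greatest P \<in> S" "w \<in> S \<Longrightarrow> w \<sqsubseteq> greatest P \<longleftrightarrow> m w b \<sqsubseteq> c"
proof -
  have P: "P bot" "\<And>x y. \<lbrakk>x \<in> S; y \<in> S; P x; P y\<rbrakk> \<Longrightarrow> P (j x y)"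
    "\<And>x y. \<lbrakk>x \<in> S; y \<in> S; x \<sqsubseteq> y; P y\<rbrakk> \<Longrightarrow> P x"
    using assms
    by (auto simp: P_def bot_le mult_bot mult_j mult_closed j_le intro: le_trans[OF mult_mono(2)])
  show "greatest P \<in> S" using greatest[of P] P by blast
  show "w \<in> S \<Longrightarrow> w \<sqsubseteq> greatest P \<longleftrightarrow> m w b \<sqsubseteq> c"
    using le_greatest_iff[of P w] P unfolding P_def by blast
qed

lemma eqI_le:
  assumes "x \<in> S" "y \<in> S" "\<And>w. w \<in> S \<Longrightarrow> w \<sqsubseteq> x \<longleftrightarrow> w \<sqsubseteq> y"
  shows "x = y"
  using assms by (meson le_antisym le_refl)

lemma algebra_rle: "\<lbrakk>x \<in> S; y \<in> S\<rbrakk> \<Longrightarrow> rle algebra x y \<longleftrightarrow> x \<sqsubseteq> y"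
proof -
  assume xy: "x \<in> S" "y \<in> S"
  have "greatest (\<lambda>z. z \<sqsubseteq> x \<and> z \<sqsubseteq> y) = x \<longleftrightarrow> x \<sqsubseteq> y"
  proof
    assume "greatest (\<lambda>z. z \<sqsubseteq> x \<and> z \<sqsubseteq> y) = x"
    then show "x \<sqsubseteq> y" using meet(2)[OF xy, of x] xy by simp
  next
    assume "x \<sqsubseteq> y"
    then show "greatest (\<lambda>z. z \<sqsubseteq> x \<and> z \<sqsubseteq> y) = x" using xy by (intro greatest_eqI) auto
  qed
  then show ?thesis by (simp add: rle_def)
qed

text \<open>The residuation laws are the characterizations of \<open>ldiv\<close> and
  \<open>rdiv\<close> as greatest solutions; associativity and commutativity of the meet come from
  comparing lower bounds.\<close>

lemma algebra_residuated_lattice: "residuated_lattice algebra"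
proof (unfold_locales, unfold algebra_fields, goal_cases)
  case (10 a b c)
  then show ?case by (intro eqI_le) (auto simp: meet)
next
  case (12 a b)
  then show ?case by (intro eqI_le) (auto simp: meet)
next
  case (14 a b)
  then show ?case by (intro eqI_le) (auto simp: meet j_closed intro: le_trans le_j1)
next
  case (15 a b)
  then have "greatest (\<lambda>z. z \<sqsubseteq> a \<and> z \<sqsubseteq> b) \<sqsubseteq> a" 
    using meet(2)[OF 15 meet(1)[OF 15]] le_refl[OF meet(1)[OF 15]] by simp
  then show ?case using j_comm[OF 15(1) meet(1)[OF 15]] by (simp add: le_def[of _ a])
next
  case (16 a b c)
  then show ?case by (simp add: algebra_rle ldiv mult_closed)
next
  case (17 a b c)
  then show ?case by (simp add: algebra_rle rdiv mult_closed)
qed (auto simp: mult_closed mult_assoc e_closed mult_e j_closed j_assoc meet ldiv rdiv intro: j_comm)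

end

section \<open>Conservative residuated lattices and idempotent chains\<close>

context residuated_lattice
begin

text \<open>Distributivity gives \<open>b\<close> join \<open>a b\<close> for the product of
  \<open>e\<close> join \<open>a\<close> with \<open>b\<close>, and \<open>a\<close> join
  \<open>a b\<close> for the product of \<open>a\<close> with \<open>e\<close> join
  \<open>b\<close>. According to whether \<open>a b\<close> is \<open>a\<close> or \<open>b\<close>,
  one of these is the join sought, and conservativity names its value.\<close>

lemma conservative_join:
  assumes "conservative A" "a \<in> carrier A" "b \<in> carrier A"
  shows "a \<^bold>\<or> b \<in> {a, b, \<one>\<^bsub>A\<^esub> \<^bold>\<or> a, \<one>\<^bsub>A\<^esub> \<^bold>\<or> b}"
proof -
  have ab: "a \<otimes>\<^bsub>A\<^esub> b \<in> {a, b}" using assms by (simp add: conservative_def)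
  have 1: "(\<one>\<^bsub>A\<^esub> \<^bold>\<or> a) \<otimes>\<^bsub>A\<^esub> b = b \<^bold>\<or> a \<otimes>\<^bsub>A\<^esub> b" "a \<otimes>\<^bsub>A\<^esub> (\<one>\<^bsub>A\<^esub> \<^bold>\<or> b) = a \<^bold>\<or> a \<otimes>\<^bsub>A\<^esub> b"
    using assms by (simp_all add: mult_join_distrib_left mult_join_distrib_right)
  have 2: "(\<one>\<^bsub>A\<^esub> \<^bold>\<or> a) \<otimes>\<^bsub>A\<^esub> b \<in> {\<one>\<^bsub>A\<^esub> \<^bold>\<or> a, b}" "a \<otimes>\<^bsub>A\<^esub> (\<one>\<^bsub>A\<^esub> \<^bold>\<or> b) \<in> {a, \<one>\<^bsub>A\<^esub> \<^bold>\<or> b}"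
    using assms unfolding conservative_def by (metis one_closed rjoin_closed)+
  show ?thesis
  proof (cases "a \<otimes>\<^bsub>A\<^esub> b = a")
    case True
    then show ?thesis using 1(1) 2(1) rjoin_comm assms by auto
  next
    case False
    then show ?thesis using ab 1(2) 2(2) by auto
  qed
qed

text \<open>The product of two positive elements is above both and equals one of them, so that one
  is the larger.\<close>

lemma conservative_join_positive:
  assumes "conservative A" "x \<in> carrier A" "y \<in> carrier A" "\<one>\<^bsub>A\<^esub> \<^bold>\<le> x" "\<one>\<^bsub>A\<^esub> \<^bold>\<le> y"
  shows "x \<^bold>\<or> y \<in> {x, y}"
proof -
  have "x \<otimes>\<^bsub>A\<^esub> \<one>\<^bsub>A\<^esub> \<^bold>\<le> x \<otimes>\<^bsub>A\<^esub> y" "\<one>\<^bsub>A\<^esub> \<otimes>\<^bsub>A\<^esub> y \<^bold>\<le> x \<otimes>\<^bsub>A\<^esub> y"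
    using assms by (intro mult_mono; simp)+
  moreover have "x \<otimes>\<^bsub>A\<^esub> y \<in> {x, y}" using assms by (simp add: conservative_def)
  ultimately show ?thesis
    using assms rjoin_comm[of x y] by (auto simp: le_iff_join)
qed

text \<open>One round of joins with the unit suffices, because \<open>conservative_join\<close> and
  \<open>conservative_join_positive\<close> leave no room for other joins. Finite sets therefore
  stay finite.\<close>

definition join_closure :: "'a set \<Rightarrow> 'a set" where
  "join_closure B = insert \<one>\<^bsub>A\<^esub> B \<union> (\<lambda>x. \<one>\<^bsub>A\<^esub> \<^bold>\<or> x) ` insert \<one>\<^bsub>A\<^esub> B"

lemma join_closure_closed:
  assumes cons: "conservative A" and B: "B \<subseteq> carrier A"
    and xy: "x \<in> join_closure B" "y \<in> join_closure B"
  shows "x \<^bold>\<or> y \<in> join_closure B"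
proof -
  define B' where "B' = insert \<one>\<^bsub>A\<^esub> B"
  define P where "P x = \<one>\<^bsub>A\<^esub> \<^bold>\<or> x" for x
  have B': "x \<in> carrier A" if "x \<in> B'" for x using that B by (auto simp: B'_def)
  have JC: "join_closure B = B' \<union> P ` B'" by (auto simp: join_closure_def B'_def P_def)
  have PP: "P a \<^bold>\<or> P b \<in> {P a, P b}" if "a \<in> B'" "b \<in> B'" for a b
    using conservative_join_positive[OF cons, of "P a" "P b"] that B' by (simp add: P_def)
  have idem: "\<one>\<^bsub>A\<^esub> \<^bold>\<or> \<one>\<^bsub>A\<^esub> = \<one>\<^bsub>A\<^esub>" by (simp flip: le_iff_join)
  \<comment> \<open>The unit in \<open>P b\<close> may be duplicated, which reduces mixed joins to
    joins of positive elements.\<close>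
  have Pa: "a \<^bold>\<or> P b = P a \<^bold>\<or> P b" if "a \<in> B'" "b \<in> B'" for a b
  proof -
    have "P a \<^bold>\<or> P b = a \<^bold>\<or> (\<one>\<^bsub>A\<^esub> \<^bold>\<or> \<one>\<^bsub>A\<^esub>) \<^bold>\<or> b"
      using that B' by (simp add: P_def rjoin_assoc rjoin_comm[of "\<one>\<^bsub>A\<^esub>" a])
    then show ?thesis using that B' by (simp add: P_def idem rjoin_assoc)
  qed
  from xy consider "x \<in> B'" "y \<in> B'" | a where "x \<in> B'" "a \<in> B'" "y = P a"
    | a where "a \<in> B'" "x = P a" "y \<in> B'" | a b where "a \<in> B'" "b \<in> B'" "x = P a" "y = P b"
    unfolding JC by blast
  then show ?thesis
  proof cases
    case 1
    then have "x \<^bold>\<or> y \<in> {x, y, P x, P y}"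
      using conservative_join[OF cons] B' by (simp add: P_def)
    then show ?thesis using 1 by (auto simp: JC)
  next
    case (2 a)
    then show ?thesis using PP[of x a] Pa[of x a] by (auto simp: JC)
  next
    case (3 a)
    then have "x \<^bold>\<or> y = y \<^bold>\<or> x" using B' by (intro rjoin_comm) (auto simp: P_def)
    then show ?thesis using 3 PP[of y a] Pa[of y a] by (auto simp: JC)
  next
    case (4 a b)
    then show ?thesis using PP[of a b] by (auto simp: JC)
  qed
qed

text \<open>\<open>T\<close> is finite, closed under joins, and closed under products by
  conservativity. A meet or residual of \<open>A\<close> that lies in \<open>B\<close> is a greatest
  solution in \<open>A\<close>, hence also the greatest one within \<open>T\<close>.\<close>

lemma conservative_finite_embedding:
  assumes cons: "conservative A" and B: "B \<subseteq> carrier A" "finite B"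
  obtains D :: "'a option rlat" where "residuated_lattice D" "conservative D" "finite (carrier D)"
    "partial_embedding A B D Some" "commutative A \<longrightarrow> commutative D"
    "totally_ordered A \<longrightarrow> totally_ordered D"
proof -
  define T where "T = join_closure B"
  define S where "S = insert None (Some ` T)"
  \<comment> \<open>\<open>None\<close> is a new bottom: absorbing for \<open>m\<close> and neutral
    for \<open>j\<close>.\<close>
  define m where "m x y = Option.bind x (\<lambda>a. map_option (mult A a) y)" for x y
  have T: "x \<in> carrier A" if "x \<in> T" for x using that B by (auto simp: T_def join_closure_def)
  have BT: "B \<subseteq> T" "\<one>\<^bsub>A\<^esub> \<in> T" by (auto simp: T_def join_closure_def)
  have m_simps [simp]: "m (Some a) (Some b) = Some (a \<otimes>\<^bsub>A\<^esub> b)" "m None x = None" "m x None = None"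
    for a b x
    by (simp_all add: m_def bind_eq_None_conv)
  define j where "j x y = (case x of None \<Rightarrow> y | Some a \<Rightarrow>
    case y of None \<Rightarrow> x | Some b \<Rightarrow> Some (a \<^bold>\<or> b))" for x y
  have j_simps [simp]: "j (Some a) (Some b) = Some (a \<^bold>\<or> b)" "j None x = x" "j x None = x" for a b x
    by (simp_all add: j_def split: option.split)
  have mT: "a \<otimes>\<^bsub>A\<^esub> b \<in> {a, b}" if "a \<in> T" "b \<in> T" for a b
    using cons that T by (simp add: conservative_def)
  have mT': "a \<otimes>\<^bsub>A\<^esub> b \<in> T" if "a \<in> T" "b \<in> T" for a b
    using mT[OF that] that by auto
  have jT: "a \<^bold>\<or> b \<in> T" if "a \<in> T" "b \<in> T" for a b
    using join_closure_closed[OF cons B(1)] that by (simp add: T_def)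
  have jc: "a \<^bold>\<or> b = b \<^bold>\<or> a" if "a \<in> T" "b \<in> T" for a b
    using that T by (simp add: rjoin_comm)
  interpret D: finite_join_monoid S m j "Some \<one>\<^bsub>A\<^esub>" None
  proof
    show "finite S" using B by (simp add: S_def T_def join_closure_def)
  qed (auto simp: S_def BT T mT' jT m_assoc rjoin_assoc meet_idem mult_join_distrib_left
      mult_join_distrib_right intro: jc simp flip: le_iff_join)
  have le: "D.le (Some a) (Some b) \<longleftrightarrow> a \<^bold>\<le> b" "D.le None (Some b)" "\<not> D.le (Some a) None"
    if "a \<in> T" "b \<in> T" for a b
    using that T by (simp_all add: D.le_def le_iff_join)
  \<comment> \<open>Maximality has to be checked only on \<open>T\<close>, since the extra element
    \<open>None\<close> is below everything.\<close>
  have gr: "D.greatest P = Some z"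
    if "z \<in> T" "P (Some z)" "\<And>w. \<lbrakk>w \<in> T; P (Some w)\<rbrakk> \<Longrightarrow> w \<^bold>\<le> z" for z P
    using that le by (intro D.greatest_eqI) (auto simp: S_def)
  note c = BT(1)[THEN subsetD] B(1)[THEN subsetD]
  have SB: "Some x \<in> S" if "x \<in> B" for x using that BT by (auto simp: S_def)
  have "partial_embedding A B D.algebra Some"
    unfolding partial_embedding_def preserves_op_def
  proof (intro conjI ballI impI)
    fix x y assume xy: "x \<in> B" "y \<in> B"
    show "Some (x \<^bold>\<and> y) = rmeet D.algebra (Some x) (Some y)" if "x \<^bold>\<and> y \<in> B"
      using xy that by (simp, intro gr[symmetric]) (auto simp: c le T le_meet_iff)
    show "Some (ldiv A x y) = ldiv D.algebra (Some x) (Some y)" if "ldiv A x y \<in> B"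
      using xy that
      by (simp, intro gr[symmetric]) (auto simp: c le T mT' ldiv_residual mult_ldiv_le)
    show "Some (rdiv A x y) = rdiv D.algebra (Some x) (Some y)" if "rdiv A x y \<in> B"
      using xy that
      by (simp, intro gr[symmetric]) (auto simp: c le T mT' rdiv_residual rdiv_mult_le)
  qed (auto simp: SB)
  moreover have "conservative D.algebra"
    unfolding conservative_def D.algebra_fields using mT by (auto simp: S_def)
  moreover have "commutative D.algebra" if "commutative A"
    unfolding commutative_def D.algebra_fields
    using that T by (auto simp: commutative_def S_def)
  moreover have "totally_ordered D.algebra" if "totally_ordered A"
    unfolding totally_ordered_def D.algebra_fields
  proof (intro ballI)
    have tot: "a \<^bold>\<le> b \<or> b \<^bold>\<le> a" if "a \<in> T" "b \<in> T" for a b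
      using \<open>totally_ordered A\<close> that T by (simp add: totally_ordered_def)
    fix x y assume xy: "x \<in> S" "y \<in> S"
    then show "rle D.algebra x y \<or> rle D.algebra y x"
      using D.bot_le[OF xy(1)] D.bot_le[OF xy(2)] tot le(1)
      by (simp add: D.algebra_rle) (auto simp: S_def)
  qed
  moreover have "finite (carrier D.algebra)" using D.finite_S by simp
  ultimately show thesis using that[OF D.algebra_residuated_lattice] by blast
qed

text \<open>By idempotence the product \<open>c\<close> of \<open>a\<close> and \<open>b\<close>
  satisfies \<open>a c = c = c b\<close>. Comparing \<open>c\<close> with the unit therefore puts it
  below both factors or above both, while monotonicity puts it between them.\<close>

lemma chain_conservative:
  assumes "totally_ordered A" "idempotent A"
  shows "conservative A"
  unfolding conservative_def
proof (intro ballI)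
  fix a b assume c: "a \<in> carrier A" "b \<in> carrier A"
  let ?c = "a \<otimes>\<^bsub>A\<^esub> b"
  have id: "x \<otimes>\<^bsub>A\<^esub> x = x" if "x \<in> carrier A" for x using assms that by (simp add: idempotent_def)
  have ac: "a \<otimes>\<^bsub>A\<^esub> ?c = ?c" and cb: "?c \<otimes>\<^bsub>A\<^esub> b = ?c"
    using c id by (simp_all add: m_assoc flip: m_assoc[of a a b])
  consider "?c \<^bold>\<le> \<one>\<^bsub>A\<^esub>" | "\<one>\<^bsub>A\<^esub> \<^bold>\<le> ?c" using assms c by (auto simp: totally_ordered_def)
  then have *: "?c \<^bold>\<le> a \<and> ?c \<^bold>\<le> b \<or> a \<^bold>\<le> ?c \<and> b \<^bold>\<le> ?c"
  proof cases
    case 1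
    then show ?thesis
      using c mult_mono_left[OF 1, of a] mult_mono_right[OF 1, of b] by (simp add: ac cb)
  next
    case 2
    then show ?thesis
      using c mult_mono_left[OF 2, of a] mult_mono_right[OF 2, of b] by (simp add: ac cb)
  qed
  consider "a \<^bold>\<le> b" | "b \<^bold>\<le> a" using assms c by (auto simp: totally_ordered_def)
  then show "?c \<in> {a, b}"
  proof cases
    case 1
    then have "a \<^bold>\<le> ?c" "?c \<^bold>\<le> b"
      using mult_mono_left[OF 1, of a] mult_mono_right[OF 1, of b] c by (simp_all add: id)
    then show ?thesis using * c le_antisym[of ?c a] le_antisym[of ?c b] by auto
  next
    case 2
    then have "b \<^bold>\<le> ?c" "?c \<^bold>\<le> a"
      using mult_mono_left[OF 2, of a] mult_mono_right[OF 2, of b] c by (simp_all add: id)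
    then show ?thesis using * c le_antisym[of ?c a] le_antisym[of ?c b] by auto
  qed
qed

end

lemma conservative_finite_nat_embedding:
  fixes A :: "'a rlat"
  assumes A: "residuated_lattice A" and cons: "conservative A" and B: "B \<subseteq> carrier A" "finite B"
  obtains D :: "nat rlat" and h where "residuated_lattice D" "conservative D" "finite (carrier D)"
    "partial_embedding A B D h" "commutative A \<longrightarrow> commutative D"
    "totally_ordered A \<longrightarrow> totally_ordered D"
proof -
  obtain D :: "'a option rlat" where D: "residuated_lattice D" "conservative D" "finite (carrier D)"
    "partial_embedding A B D Some" "commutative A \<longrightarrow> commutative D"
    "totally_ordered A \<longrightarrow> totally_ordered D"
    using residuated_lattice.conservative_finite_embedding[OF assms] by blast
  obtain f :: "'a option \<Rightarrow> nat" where "transport D (carrier D) f"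
    using finite_nat_copy D by blast
  then interpret transport D "carrier D" f .
  show thesis
    by (rule that[OF tr_residuated_lattice])
      (use D tr_conservative tr_commutative tr_totally_ordered tr_partial_embedding
        in \<open>auto simp: tr_simps\<close>)
qed

section \<open>The generated varieties\<close>

text \<open>Orthogonality of the values of \<open>s\<close> and \<open>t\<close> passes from
  \<open>K\<close> to \<open>A\<close> as equations, and a separating quotient turns it back into a
  disjunction. \<open>U\<close> and \<open>V\<close> name the values of these terms in the variables
  0 and 1.\<close>

lemma separating_image:
  fixes K :: "'u rlat set" and A :: "'a rlat" and U V :: "'a \<Rightarrow> 'a \<Rightarrow> 'a"
  assumes K: "\<And>C \<rho>. \<lbrakk>C \<in> K; range \<rho> \<subseteq> carrier C\<rbrakk> \<Longrightarrow>
      residuated_lattice.orthogonal C (eval_term C \<rho> s) (eval_term C \<rho> t)"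
    and RL: "\<And>C. C \<in> K \<Longrightarrow> residuated_lattice C"
    and A: "A \<in> models (equations_of K)"
    and UV: "\<And>\<rho>. eval_term A \<rho> s = U (\<rho> 0) (\<rho> (Suc 0))" "\<And>\<rho>. eval_term A \<rho> t = V (\<rho> 0) (\<rho> (Suc 0))"
    and neg: "\<And>x y. \<lbrakk>x \<in> carrier A; y \<in> carrier A\<rbrakk> \<Longrightarrow>
      U x y \<in> residuated_lattice.neg_cone A \<and> V x y \<in> residuated_lattice.neg_cone A"
    and ab: "a \<in> carrier A" "b \<in> carrier A" "a \<noteq> b"
  obtains C :: "'a rlat" and h where "residuated_lattice C" "rl_hom A C h" "carrier C = h ` carrier A"
    "h a \<noteq> h b"
    "\<forall>x\<in>carrier A. \<forall>y\<in>carrier A. h (U x y) = \<one>\<^bsub>C\<^esub> \<or> h (V x y) = \<one>\<^bsub>C\<^esub>"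
proof -
  interpret residuated_lattice A using A by (simp add: models_def)
  have orth: "orthogonal (U x y) (V x y)" if xy: "x \<in> carrier A" "y \<in> carrier A" for x y
    unfolding orthogonal_def
  proof (intro allI impI)
    fix ps qs :: "(bool \<times> 'a) list"
    assume ps: "snd ` set ps \<subseteq> carrier A" "snd ` set qs \<subseteq> carrier A"
    obtain \<rho> where "\<rho> 0 = x" "\<rho> (Suc 0) = y"
      "iterated_conjugate A ps (eval_term A \<rho> s) \<^bold>\<or> iterated_conjugate A qs (eval_term A \<rho> t) = \<one>\<^bsub>A\<^esub>"
      by (rule orthogonal_in_models[OF K RL A xy ps])
    then show "iterated_conjugate A ps (U x y) \<^bold>\<or> iterated_conjugate A qs (V x y) = \<one>\<^bsub>A\<^esub>"
      by (simp add: UV)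
  qed
  obtain C :: "'a rlat" and h where C: "residuated_lattice C" "rl_hom A C h" "carrier C = h ` carrier A"
    "h a \<noteq> h b"
    "\<forall>u\<in>neg_cone. \<forall>v\<in>neg_cone. orthogonal u v \<longrightarrow> h u = \<one>\<^bsub>C\<^esub> \<or> h v = \<one>\<^bsub>C\<^esub>"
    by (rule separating_quotient[OF ab])
  show thesis by (rule that[OF C(1-4)]) (use C(5) orth neg in blast)
qed

text \<open>Conservativity says that one of two biresiduals is the unit, so in \<open>K\<close> the
  pair is orthogonal. The disjunction returned in the quotient is conservativity again, as
  \<open>h\<close> is onto.\<close>

lemma conservative_image:
  fixes K :: "'u rlat set" and A :: "'a rlat"
  assumes K: "\<And>C. C \<in> K \<Longrightarrow> residuated_lattice C \<and> conservative C"
    and A: "A \<in> models (equations_of K)"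
    and ab: "a \<in> carrier A" "b \<in> carrier A" "a \<noteq> b"
  obtains C :: "'a rlat" and h where "residuated_lattice C" "conservative C" "rl_hom A C h"
    "carrier C = h ` carrier A" "h a \<noteq> h b"
proof -
  interpret residuated_lattice A using A by (simp add: models_def)
  define s where "s n = (let x = Mult (Var 0) (Var 1); y = Var n
    in Meet Unit (Meet (LDiv x y) (LDiv y x)))" for n
  have s: "eval_term C \<rho> (s n) = biresidual C (\<rho> 0 \<otimes>\<^bsub>C\<^esub> \<rho> 1) (\<rho> n)" for C :: "'c rlat" and \<rho> n
    by (simp add: s_def biresidual_def Let_def)
  have orth: "residuated_lattice.orthogonal C (eval_term C \<rho> (s 0)) (eval_term C \<rho> (s 1))"
    if "C \<in> K" "range \<rho> \<subseteq> carrier C" for C :: "'u rlat" and \<rho>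
  proof -
    interpret C: residuated_lattice C using K that by blast
    have c: "\<rho> n \<in> carrier C" for n using that by auto
    have "\<rho> 0 \<otimes>\<^bsub>C\<^esub> \<rho> 1 = \<rho> 0 \<or> \<rho> 0 \<otimes>\<^bsub>C\<^esub> \<rho> 1 = \<rho> 1"
      using K[OF that(1)] c by (simp add: conservative_def)
    then show ?thesis
      unfolding s by (intro C.orthogonal_one) (simp_all add: c C.biresidual_neg C.eq_iff_biresidual)
  qed
  obtain C :: "'a rlat" and h where C: "residuated_lattice C" "rl_hom A C h" "carrier C = h ` carrier A"
    "h a \<noteq> h b"
    and one: "\<forall>x\<in>carrier A. \<forall>y\<in>carrier A.
      h (biresidual A (x \<otimes>\<^bsub>A\<^esub> y) x) = \<one>\<^bsub>C\<^esub> \<or> h (biresidual A (x \<otimes>\<^bsub>A\<^esub> y) y) = \<one>\<^bsub>C\<^esub>"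
    by (rule separating_image[of K "s 0" "s 1" A "\<lambda>x y. biresidual A (x \<otimes>\<^bsub>A\<^esub> y) x"
          "\<lambda>x y. biresidual A (x \<otimes>\<^bsub>A\<^esub> y) y", OF orth _ A _ _ _ ab])
      (use K in \<open>auto simp: s biresidual_neg\<close>)
  interpret C: residuated_lattice C by fact
  have hom: "h (biresidual A x y) = biresidual C (h x) (h y)" "h x \<in> carrier C"
    "h (x \<otimes>\<^bsub>A\<^esub> y) = h x \<otimes>\<^bsub>C\<^esub> h y" if "x \<in> carrier A" "y \<in> carrier A" for x y
    using C(2) that by (auto simp: rl_hom_def biresidual_def)
  have "h x \<otimes>\<^bsub>C\<^esub> h y \<in> {h x, h y}" if "x \<in> carrier A" "y \<in> carrier A" for x y
    using one[rule_format, OF that] that hom by (auto simp: C.eq_iff_biresidual)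
  then have "conservative C" by (auto simp: conservative_def C(3))
  with C that show thesis by blast
qed

text \<open>The same scheme with comparability as the disjunction: \<open>x\<close> is below
  \<open>y\<close> exactly when the residual from \<open>x\<close> to \<open>y\<close>, met with the
  unit, is the unit.\<close>

lemma chain_image:
  fixes K :: "'u rlat set" and A :: "'a rlat"
  assumes K: "\<And>C. C \<in> K \<Longrightarrow> residuated_lattice C \<and> totally_ordered C"
    and A: "A \<in> models (equations_of K)"
    and ab: "a \<in> carrier A" "b \<in> carrier A" "a \<noteq> b"
  obtains C :: "'a rlat" and h where "residuated_lattice C" "totally_ordered C" "rl_hom A C h"
    "carrier C = h ` carrier A" "h a \<noteq> h b"
proof -
  interpret residuated_lattice A using A by (simp add: models_def)
  define s where "s m n = Meet Unit (LDiv (Var m) (Var n))" for m n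
  have orth: "residuated_lattice.orthogonal C (eval_term C \<rho> (s 0 1)) (eval_term C \<rho> (s 1 0))"
    if "C \<in> K" "range \<rho> \<subseteq> carrier C" for C :: "'u rlat" and \<rho>
  proof -
    interpret C: residuated_lattice C using K that by blast
    have c: "\<rho> n \<in> carrier C" for n using that by auto
    have "rle C (\<rho> 0) (\<rho> 1) \<or> rle C (\<rho> 1) (\<rho> 0)"
      using K[OF that(1)] c by (simp add: totally_ordered_def)
    then show ?thesis
      by (intro C.orthogonal_one) (auto simp: s_def c C.le_iff_ldiv)
  qed
  obtain C :: "'a rlat" and h where C: "residuated_lattice C" "rl_hom A C h" "carrier C = h ` carrier A"
    "h a \<noteq> h b"
    and one: "\<forall>x\<in>carrier A. \<forall>y\<in>carrier A.
      h (\<one>\<^bsub>A\<^esub> \<^bold>\<and> ldiv A x y) = \<one>\<^bsub>C\<^esub> \<or> h (\<one>\<^bsub>A\<^esub> \<^bold>\<and> ldiv A y x) = \<one>\<^bsub>C\<^esub>"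
    by (rule separating_image[of K "s 0 1" "s 1 0" A "\<lambda>x y. \<one>\<^bsub>A\<^esub> \<^bold>\<and> ldiv A x y"
          "\<lambda>x y. \<one>\<^bsub>A\<^esub> \<^bold>\<and> ldiv A y x", OF orth _ A _ _ _ ab])
      (use K in \<open>auto simp: s_def\<close>)
  interpret C: residuated_lattice C by fact
  have hom: "h (\<one>\<^bsub>A\<^esub> \<^bold>\<and> ldiv A x y) = rmeet C \<one>\<^bsub>C\<^esub> (ldiv C (h x) (h y))" "h x \<in> carrier C"
    if "x \<in> carrier A" "y \<in> carrier A" for x y
    using C(2) that by (auto simp: rl_hom_def)
  have "totally_ordered C"
    unfolding totally_ordered_def C(3) using one hom by (auto simp: C.le_iff_ldiv)
  with C that show thesis by blast
qed

section \<open>Identities and homomorphic images\<close>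

lemma idempotent_in_models:
  assumes "\<And>C. C \<in> K \<Longrightarrow> idempotent C" "A \<in> models (equations_of K)"
  shows "idempotent A"
proof -
  have "(Mult (Var 0) (Var 0), Var 0) \<in> equations_of K"
    using assms(1) by (auto simp: equations_of_def satisfies_def idempotent_def image_subset_iff)
  then have sat: "satisfies A (Mult (Var 0) (Var 0), Var 0)" using assms(2) by (auto simp: models_def)
  show ?thesis
    unfolding idempotent_def
  proof
    fix a assume "a \<in> carrier A"
    then show "a \<otimes>\<^bsub>A\<^esub> a = a"
      using sat[unfolded satisfies_def, rule_format, of "\<lambda>_. a"] by auto
  qed
qed

lemma commutative_in_models:
  assumes "\<And>C. C \<in> K \<Longrightarrow> commutative C" "A \<in> models (equations_of K)"
  shows "commutative A"
proof -
  let ?e = "(Mult (Var 0) (Var 1), Mult (Var 1) (Var 0))"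
  have "?e \<in> equations_of K"
    using assms(1) by (auto simp: equations_of_def satisfies_def commutative_def image_subset_iff)
  then have sat: "satisfies A ?e" using assms(2) by (auto simp: models_def)
  show ?thesis
    unfolding commutative_def
  proof (intro ballI)
    fix a b assume "a \<in> carrier A" "b \<in> carrier A"
    then show "a \<otimes>\<^bsub>A\<^esub> b = b \<otimes>\<^bsub>A\<^esub> a"
      using sat[unfolded satisfies_def, rule_format, of "\<lambda>n. if n = 0 then a else b"] by auto
  qed
qed

lemma hom_image_properties:
  assumes "rl_hom A C h" "carrier C = h ` carrier A"
  shows "commutative A \<Longrightarrow> commutative C" "idempotent A \<Longrightarrow> idempotent C"
  using assms by (auto simp: rl_hom_def commutative_def idempotent_def) metis+

lemma conservative_idempotent: "conservative A \<Longrightarrow> idempotent A"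
  by (auto simp: conservative_def idempotent_def)

theorem corollary5p2:
  assumes "infinite (UNIV :: 'u set)"
  shows "finite_embeddability_property TYPE('a)
           (equations_of (conservative_rls :: 'u rlat set)) \<and>
         finite_embeddability_property TYPE('a)
           (equations_of (commutative_conservative_rls :: 'u rlat set)) \<and>
         finite_embeddability_property TYPE('a)
           (equations_of (totally_ordered_idempotent_rls :: 'u rlat set))"
proof (intro conjI)
  \<comment> \<open>Equations valid in the generators over \<open>'u\<close> also hold in those over
    \<open>nat\<close>, where the finite algebras live.\<close>
  note eqs = equations_of_universe_mono[OF assms]
  show "finite_embeddability_property TYPE('a) (equations_of (conservative_rls :: 'u rlat set))"
  proof (rule fep_from_generators[OF _ _ _ eqs(1)])
    fix A :: "'a rlat" and a b
    assume A: "A \<in> models (equations_of (conservative_rls :: 'u rlat set))"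
      "a \<in> carrier A" "b \<in> carrier A" "a \<noteq> b"
    show "\<exists>C\<in>conservative_rls :: 'a rlat set. \<exists>g. rl_hom A C g \<and> g a \<noteq> g b"
      by (rule conservative_image[OF _ A]) (auto simp: conservative_rls_def)
  next
    fix C :: "'a rlat" and B assume C: "C \<in> conservative_rls" "B \<subseteq> carrier C" "finite B"
    then have "residuated_lattice C" "conservative C" by (simp_all add: conservative_rls_def)
    then show "\<exists>D\<in>conservative_rls :: nat rlat set. finite (carrier D) \<and> (\<exists>h. partial_embedding C B D h)"
      by (rule conservative_finite_nat_embedding[OF _ _ C(2,3)])
        (use C(1) in \<open>auto simp: conservative_rls_def\<close>)
  qed (simp add: conservative_rls_def)
  show "finite_embeddability_property TYPE('a)
    (equations_of (commutative_conservative_rls :: 'u rlat set))"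
  proof (rule fep_from_generators[OF _ _ _ eqs(2)])
    fix A :: "'a rlat" and a b
    assume A: "A \<in> models (equations_of (commutative_conservative_rls :: 'u rlat set))"
      "a \<in> carrier A" "b \<in> carrier A" "a \<noteq> b"
    \<comment> \<open>Commutativity is an identity, so it passes from the generators to
      \<open>A\<close> and then to homomorphic images; conservativity of the image comes from the
      separation.\<close>
    have comm: "commutative A"
      by (rule commutative_in_models[OF _ A(1)]) (simp add: commutative_conservative_rls_def)
    show "\<exists>C\<in>commutative_conservative_rls :: 'a rlat set. \<exists>g. rl_hom A C g \<and> g a \<noteq> g b"
      by (rule conservative_image[OF _ A])
        (use comm in \<open>auto simp: commutative_conservative_rls_def intro: hom_image_properties\<close>)
  next
    fix C :: "'a rlat" and B assume C: "C \<in> commutative_conservative_rls" "B \<subseteq> carrier C" "finite B"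
    then have "residuated_lattice C" "conservative C" by (simp_all add: commutative_conservative_rls_def)
    then show "\<exists>D\<in>commutative_conservative_rls :: nat rlat set.
        finite (carrier D) \<and> (\<exists>h. partial_embedding C B D h)"
      by (rule conservative_finite_nat_embedding[OF _ _ C(2,3)])
        (use C(1) in \<open>auto simp: commutative_conservative_rls_def\<close>)
  qed (simp add: commutative_conservative_rls_def)
  show "finite_embeddability_property TYPE('a)
    (equations_of (totally_ordered_idempotent_rls :: 'u rlat set))"
  proof (rule fep_from_generators[OF _ _ _ eqs(3)])
    fix A :: "'a rlat" and a b
    assume A: "A \<in> models (equations_of (totally_ordered_idempotent_rls :: 'u rlat set))"
      "a \<in> carrier A" "b \<in> carrier A" "a \<noteq> b"
    have idem: "idempotent A"
      by (rule idempotent_in_models[OF _ A(1)]) (simp add: totally_ordered_idempotent_rls_def)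
    show "\<exists>C\<in>totally_ordered_idempotent_rls :: 'a rlat set. \<exists>g. rl_hom A C g \<and> g a \<noteq> g b"
      by (rule chain_image[OF _ A])
        (use idem in \<open>auto simp: totally_ordered_idempotent_rls_def intro: hom_image_properties\<close>)
  next
    fix C :: "'a rlat" and B assume C: "C \<in> totally_ordered_idempotent_rls" "B \<subseteq> carrier C" "finite B"
    \<comment> \<open>Idempotent chains are conservative, so the same embedding applies. Its target
      is again a chain, and it is idempotent because it is conservative.\<close>
    then have "residuated_lattice C" "conservative C"
      by (auto simp: totally_ordered_idempotent_rls_def residuated_lattice.chain_conservative)
    then show "\<exists>D\<in>totally_ordered_idempotent_rls :: nat rlat set.
        finite (carrier D) \<and> (\<exists>h. partial_embedding C B D h)"
      by (rule conservative_finite_nat_embedding[OF _ _ C(2,3)])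
        (use C(1) in \<open>auto simp: totally_ordered_idempotent_rls_def conservative_idempotent\<close>)
  qed (simp add: totally_ordered_idempotent_rls_def)
qed

end
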